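(* Let $(M,g,I_1,I_2,I_3)$ be a locally conformally hyperkähler manifold whose Lee form $\theta$ is parallel with respect to the Levi-Civita connection of $g$. Assume that $\theta$ has unit length with respect to $g$, and let $\theta_r=I_r\theta$ for $r=1,2,3$. Then $$\hat g=g-\tfrac12\{\theta\otimes\theta+\theta_1\otimes\theta_1+\theta_2\otimes\theta_2+\theta_3\otimes\theta_3\}$$ is an HKT metric (that is, $(M,\hat g,I_1,I_2,I_3)$ is an HKT-manifold). Moreover, $-\theta$ is a closed potential 1-form for $\hat g$.
   Context: A hypercomplex structure on a smooth manifold $M$ is a triple of integrable complex structures $I_1,I_2,I_3$ with $I_1^2=I_2^2=I_3^2=-\mathrm{Id}$ and $I_1I_2=I_3=-I_2I_1$. With a Riemannian metric $g$ satisfying $g(I_rX,I_rY)=g(X,Y)$ for $r=1,2,3$, $(M,g,I_1,I_2,I_3)$ is called hyperhermitian. It is hyperkähler if the Levi-Civita connection $\nabla$ of $g$ satisfies $\nabla I_r=0$ for all $r$. It is locally conformally hyperkähler if there are an open cover $\{U_i\}$ and smooth functions $f_i$ on $U_i$ with $g|_{U_i}=e^{f_i}g_i$, where each $g_i$ is a hyperkähler metric on $U_i$ (with respect to $I_1,I_2,I_3$). The Lee form is the globally defined closed 1-form $\theta$ with $\theta|_{U_i}=df_i$; it satisfies $dF_r=\theta\wedge F_r$ for $F_r(X,Y)=g(I_rX,Y)$. An HKT-connection on a hyperhermitian manifold $(M,\hat g,I_1,I_2,I_3)$ is a linear connection $D$ with torsion tensor $T^D$ such that $D\hat g=0$, $DI_r=0$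 for all $r$, and $c(X,Y,Z)=\hat g(T^D(X,Y),Z)$ is a 3-form. When it exists it is unique, and $(M,\hat g,I_1,I_2,I_3)$ is called an HKT-manifold. For a $k$-form $\omega$: $(I_r\omega)(X_1,\dots,X_k)=(-1)^k\omega(I_rX_1,\dots,I_rX_k)$ and $d_r\omega=(-1)^kI_r\,d\,I_r\omega$. With $\hat F_r(X,Y)=\hat g(I_rX,Y)$, a 1-form $\omega$ is a potential 1-form for $\hat g$ if, with $\omega_r=I_r\omega$, $$\hat F_1=\tfrac12(d\omega_1+d_2\omega_3),\quad \hat F_2=\tfrac12(d\omega_2+d_3\omega_1),\quad \hat F_3=\tfrac12(d\omega_3+d_1\omega_2).$$ It is closed if $d\omega=0$. *)

theory Defs
  imports "HOL-Analysis.Analysis" "HOL-Library.Function_Algebras"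
begin

section \<open>Function spaces as real vector spaces\<close>

instantiation "fun" :: (type, scaleR) scaleR
begin
definition scaleR_fun_def: "a *\<^sub>R f = (\<lambda>x. a *\<^sub>R f x)"
instance ..
end

lemma scaleR_fun_apply [simp]: "(a *\<^sub>R f) x = a *\<^sub>R f x"
  by (simp add: scaleR_fun_def)

instance "fun" :: (type, real_vector) real_vector
  by standard (simp_all add: fun_eq_iff algebra_simps)

definition linear_on_subspace :: "'v::real_vector set \<Rightarrow> ('v \<Rightarrow> 'w::real_vector) \<Rightarrow> bool" where
  "linear_on_subspace S h \<longleftrightarrow>
     (\<forall>a b. \<forall>v\<in>S. \<forall>w\<in>S. h (a *\<^sub>R v + b *\<^sub>R w) = a *\<^sub>R h v + b *\<^sub>R h w)"

section \<open>Smooth manifolds\<close>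

text \<open>\<open>Ck_on\<close> and \<open>smooth_on\<close> are meant for open sets \<open>S\<close> only.\<close>

primrec Ck_on :: "nat \<Rightarrow> 'e::euclidean_space set \<Rightarrow> ('e \<Rightarrow> 'b::real_normed_vector) \<Rightarrow> bool" where
  "Ck_on 0 S f \<longleftrightarrow> continuous_on S f"
| "Ck_on (Suc n) S f \<longleftrightarrow> (\<forall>x\<in>S. f differentiable (at x)) \<and>
     (\<forall>e. Ck_on n S (\<lambda>x. frechet_derivative f (at x) e))"

definition smooth_on :: "'e::euclidean_space set \<Rightarrow> ('e \<Rightarrow> 'b::real_normed_vector) \<Rightarrow> bool" where
  "smooth_on S f \<longleftrightarrow> (\<forall>n. Ck_on n S f)"

text \<open>A chart is a pair of its domain and its coordinate map; outside the domain the coordinate map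
  is irrelevant.\<close>

type_synonym ('a, 'e) chart = "'a set \<times> ('a \<Rightarrow> 'e)"

record ('a, 'e) manifold =
  mtop :: "'a topology"
  atlas :: "('a, 'e) chart set"

abbreviation points :: "('a, 'e) manifold \<Rightarrow> 'a set" where
  "points M \<equiv> topspace (mtop M)"

definition chart_inv :: "('a, 'e) chart \<Rightarrow> 'e \<Rightarrow> 'a" where
  "chart_inv c = inv_into (fst c) (snd c)"

definition smooth_transition ::
    "('a, 'e::euclidean_space) chart \<Rightarrow> ('a, 'e) chart \<Rightarrow> bool" where
  "smooth_transition c d \<longleftrightarrow> smooth_on (snd c ` (fst c \<inter> fst d)) (snd d \<circ> chart_inv c)"

text \<open>\<open>is_chart M c\<close>: \<open>c\<close> belongs to the maximal atlas generated by \<open>atlas M\<close>.\<close>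

definition is_chart :: "('a, 'e::euclidean_space) manifold \<Rightarrow> ('a, 'e) chart \<Rightarrow> bool" where
  "is_chart M c \<longleftrightarrow>
     openin (mtop M) (fst c) \<and> open (snd c ` fst c) \<and>
     homeomorphic_map (subtopology (mtop M) (fst c)) (top_of_set (snd c ` fst c)) (snd c) \<and>
     (\<forall>d\<in>atlas M. smooth_transition c d \<and> smooth_transition d c)"

definition smooth_manifold :: "('a, 'e::euclidean_space) manifold \<Rightarrow> bool" where
  "smooth_manifold M \<longleftrightarrow>
     Hausdorff_space (mtop M) \<and> second_countable (mtop M) \<and>
     (\<forall>c\<in>atlas M. is_chart M c) \<and> (\<Union>c\<in>atlas M. fst c) = points M"

definition smooth_fun ::
    "('a, 'e::euclidean_space) manifold \<Rightarrow> 'a set \<Rightarrow> ('a \<Rightarrow> real) \<Rightarrow> bool" where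
  "smooth_fun M V f \<longleftrightarrow> openin (mtop M) V \<and>
     (\<forall>c\<in>atlas M. smooth_on (snd c ` (fst c \<inter> V)) (f \<circ> chart_inv c))"

definition smooth_near ::
    "('a, 'e::euclidean_space) manifold \<Rightarrow> 'a \<Rightarrow> ('a \<Rightarrow> real) \<Rightarrow> bool" where
  "smooth_near M p f \<longleftrightarrow> (\<exists>V. p \<in> V \<and> smooth_fun M V f)"

section \<open>Tangent vectors and vector fields\<close>

text \<open>A tangent vector at \<open>p\<close> is a directional derivative in some chart, regarded as an operator on
  the functions that are smooth near \<open>p\<close>. It is normalised to vanish on all other
  functions, so that equality of tangent vectors is equality of operators.\<close>

type_synonym 'a tvec = "('a \<Rightarrow> real) \<Rightarrow> real"
type_synonym 'a vfield = "'a \<Rightarrow> 'a tvec"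
type_synonym 'a endo = "'a \<Rightarrow> 'a tvec \<Rightarrow> 'a tvec"
type_synonym 'a bilin = "'a \<Rightarrow> 'a tvec \<Rightarrow> 'a tvec \<Rightarrow> real"
type_synonym 'a kform = "'a \<Rightarrow> 'a tvec list \<Rightarrow> real"

definition coord_vec ::
    "('a, 'e::euclidean_space) manifold \<Rightarrow> ('a, 'e) chart \<Rightarrow> 'a \<Rightarrow> 'e \<Rightarrow> 'a tvec" where
  "coord_vec M c p e = (\<lambda>f. if smooth_near M p f
     then frechet_derivative (f \<circ> chart_inv c) (at (snd c p)) e else 0)"

definition tangent_space :: "('a, 'e::euclidean_space) manifold \<Rightarrow> 'a \<Rightarrow> 'a tvec set" where
  "tangent_space M p = {coord_vec M c p e | c e. c \<in> atlas M \<and> p \<in> fst c}"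

text \<open>\<open>vector_field M V X\<close>: \<open>X\<close> is a smooth vector field on the open set \<open>V\<close>; its values outside
  \<open>V\<close> are irrelevant.\<close>

definition vector_field ::
    "('a, 'e::euclidean_space) manifold \<Rightarrow> 'a set \<Rightarrow> 'a vfield \<Rightarrow> bool" where
  "vector_field M V X \<longleftrightarrow> openin (mtop M) V \<and> (\<forall>p\<in>V. X p \<in> tangent_space M p) \<and>
     (\<forall>W f. W \<subseteq> V \<and> smooth_fun M W f \<longrightarrow> smooth_fun M W (\<lambda>p. X p f))"

definition lie_bracket ::
    "('a, 'e::euclidean_space) manifold \<Rightarrow> 'a vfield \<Rightarrow> 'a vfield \<Rightarrow> 'a vfield" where
  "lie_bracket M X Y = (\<lambda>p f. if smooth_near M p f
     then X p (\<lambda>q. Y q f) - Y p (\<lambda>q. X q f) else 0)"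

section \<open>Tensor fields on an open set\<close>

definition endo_field ::
    "('a, 'e::euclidean_space) manifold \<Rightarrow> 'a set \<Rightarrow> 'a endo \<Rightarrow> bool" where
  "endo_field M U I \<longleftrightarrow>
     (\<forall>p\<in>U. linear_on_subspace (tangent_space M p) (I p) \<and>
        (\<forall>v\<in>tangent_space M p. I p v \<in> tangent_space M p)) \<and>
     (\<forall>V X. V \<subseteq> U \<and> vector_field M V X \<longrightarrow> vector_field M V (\<lambda>p. I p (X p)))"

definition riemannian_metric ::
    "('a, 'e::euclidean_space) manifold \<Rightarrow> 'a set \<Rightarrow> 'a bilin \<Rightarrow> bool" where
  "riemannian_metric M U g \<longleftrightarrow>
     (\<forall>p\<in>U. \<forall>v\<in>tangent_space M p.
        linear_on_subspace (tangent_space M p) (g p v) \<and>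
        (\<forall>w\<in>tangent_space M p. g p v w = g p w v) \<and>
        (v \<noteq> 0 \<longrightarrow> g p v v > 0)) \<and>
     (\<forall>V X Y. V \<subseteq> U \<and> vector_field M V X \<and> vector_field M V Y \<longrightarrow>
        smooth_fun M V (\<lambda>p. g p (X p) (Y p)))"

definition is_form ::
    "('a, 'e::euclidean_space) manifold \<Rightarrow> 'a set \<Rightarrow> nat \<Rightarrow> 'a kform \<Rightarrow> bool" where
  "is_form M U k \<omega> \<longleftrightarrow>
     (\<forall>p\<in>U. \<forall>vs. length vs = k \<and> set vs \<subseteq> tangent_space M p \<longrightarrow>
        (\<forall>i<k. linear_on_subspace (tangent_space M p) (\<lambda>v. \<omega> p (vs[i := v]))) \<and>
        (\<forall>i<k. \<forall>j<k. i \<noteq> j \<and> vs ! i = vs ! j \<longrightarrow> \<omega> p vs = 0)) \<and>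
     (\<forall>V Xs. V \<subseteq> U \<and> length Xs = k \<and> (\<forall>X\<in>set Xs. vector_field M V X) \<longrightarrow>
        smooth_fun M V (\<lambda>p. \<omega> p (map (\<lambda>X. X p) Xs)))"

text \<open>The exterior derivative is given by its usual coordinate expression: the arguments are extended
  by vector fields with constant coefficients in a chart around \<open>p\<close>. These commute, so
  the bracket terms of the invariant formula are absent. The normalisation is
  \<open>d\<omega>(X,Y) = X\<omega>(Y) - Y\<omega>(X) - \<omega>([X,Y])\<close> for 1-forms, without a factor 1/2.\<close>

definition chart_at :: "('a, 'e::euclidean_space) manifold \<Rightarrow> 'a \<Rightarrow> ('a, 'e) chart" where
  "chart_at M p = (SOME c. c \<in> atlas M \<and> p \<in> fst c)"

definition coord_extension ::
    "('a, 'e::euclidean_space) manifold \<Rightarrow> 'a \<Rightarrow> 'a tvec \<Rightarrow> 'a vfield" where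
  "coord_extension M p v =
     (\<lambda>q. coord_vec M (chart_at M p) q (SOME e. coord_vec M (chart_at M p) p e = v))"

definition ext_deriv ::
    "('a, 'e::euclidean_space) manifold \<Rightarrow> 'a kform \<Rightarrow> 'a kform" where
  "ext_deriv M \<omega> = (\<lambda>p vs. \<Sum>i<length vs. (-1) ^ i *
     (vs ! i) (\<lambda>q. \<omega> q (map (\<lambda>v. coord_extension M p v q) (take i vs @ drop (Suc i) vs))))"

definition closed_form ::
    "('a, 'e::euclidean_space) manifold \<Rightarrow> 'a set \<Rightarrow> nat \<Rightarrow> 'a kform \<Rightarrow> bool" where
  "closed_form M U k \<omega> \<longleftrightarrow> is_form M U k \<omega> \<and>
     (\<forall>p\<in>U. \<forall>vs. length vs = Suc k \<and> set vs \<subseteq> tangent_space M p \<longrightarrow> ext_deriv M \<omega> p vs = 0)"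

definition form_act :: "'a endo \<Rightarrow> 'a kform \<Rightarrow> 'a kform" where
  "form_act I \<omega> = (\<lambda>p vs. (-1) ^ length vs * \<omega> p (map (I p) vs))"

text \<open>\<open>twisted_deriv M I\<^sub>r k \<omega>\<close> is \<open>d\<^sub>r \<omega>\<close> for a \<open>k\<close>-form \<open>\<omega>\<close>.\<close>

definition twisted_deriv ::
    "('a, 'e::euclidean_space) manifold \<Rightarrow> 'a endo \<Rightarrow> nat \<Rightarrow> 'a kform \<Rightarrow> 'a kform" where
  "twisted_deriv M I k \<omega> = (\<lambda>p vs. (-1) ^ k * form_act I (ext_deriv M (form_act I \<omega>)) p vs)"

definition fundamental_form :: "'a bilin \<Rightarrow> 'a endo \<Rightarrow> 'a kform" where
  "fundamental_form g I = (\<lambda>p vs. g p (I p (vs ! 0)) (vs ! 1))"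

text \<open>The norm of a covector is the norm of its metric dual.\<close>

definition sharp ::
    "('a, 'e::euclidean_space) manifold \<Rightarrow> 'a bilin \<Rightarrow> 'a kform \<Rightarrow> 'a vfield" where
  "sharp M g \<omega> p = (THE x. x \<in> tangent_space M p \<and>
     (\<forall>w\<in>tangent_space M p. g p x w = \<omega> p [w]))"

definition form_norm ::
    "('a, 'e::euclidean_space) manifold \<Rightarrow> 'a bilin \<Rightarrow> 'a kform \<Rightarrow> 'a \<Rightarrow> real" where
  "form_norm M g \<omega> p = sqrt (g p (sharp M g \<omega> p) (sharp M g \<omega> p))"

section \<open>Linear connections\<close>

text \<open>A linear connection on \<open>U\<close> is given as a covariant derivative \<open>D p v Y\<close> of a vector field \<open>Y\<close>,
  defined on an open neighbourhood of \<open>p\<close>, in the direction of a tangent vector \<open>v\<close> at \<open>p\<close>.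
  The last clause says that the values of \<open>Y\<close> away from a neighbourhood of \<open>p\<close> do not matter.\<close>

type_synonym 'a connection = "'a \<Rightarrow> 'a tvec \<Rightarrow> 'a vfield \<Rightarrow> 'a tvec"

definition linear_connection ::
    "('a, 'e::euclidean_space) manifold \<Rightarrow> 'a set \<Rightarrow> 'a connection \<Rightarrow> bool" where
  "linear_connection M U D \<longleftrightarrow>
     (\<forall>V X Y. V \<subseteq> U \<and> vector_field M V X \<and> vector_field M V Y \<longrightarrow>
        vector_field M V (\<lambda>p. D p (X p) Y)) \<and>
     (\<forall>V Y. V \<subseteq> U \<and> vector_field M V Y \<longrightarrow>
        (\<forall>p\<in>V. linear_on_subspace (tangent_space M p) (\<lambda>v. D p v Y) \<and>
           (\<forall>v\<in>tangent_space M p. D p v Y \<in> tangent_space M p))) \<and>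
     (\<forall>V Y Z. V \<subseteq> U \<and> vector_field M V Y \<and> vector_field M V Z \<longrightarrow>
        (\<forall>p\<in>V. \<forall>v\<in>tangent_space M p. D p v (Y + Z) = D p v Y + D p v Z)) \<and>
     (\<forall>V f Y. V \<subseteq> U \<and> smooth_fun M V f \<and> vector_field M V Y \<longrightarrow>
        (\<forall>p\<in>V. \<forall>v\<in>tangent_space M p.
           D p v (\<lambda>q. f q *\<^sub>R Y q) = v f *\<^sub>R Y p + f p *\<^sub>R D p v Y)) \<and>
     (\<forall>V Y Z. V \<subseteq> U \<and> vector_field M V Y \<and> vector_field M V Z \<and> (\<forall>q\<in>V. Y q = Z q) \<longrightarrow>
        (\<forall>p\<in>V. \<forall>v\<in>tangent_space M p. D p v Y = D p v Z))"

definition torsion ::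
    "('a, 'e::euclidean_space) manifold \<Rightarrow> 'a connection \<Rightarrow> 'a vfield \<Rightarrow> 'a vfield \<Rightarrow> 'a vfield" where
  "torsion M D X Y = (\<lambda>p. D p (X p) Y - D p (Y p) X - lie_bracket M X Y p)"

definition parallel_metric ::
    "('a, 'e::euclidean_space) manifold \<Rightarrow> 'a set \<Rightarrow> 'a connection \<Rightarrow> 'a bilin \<Rightarrow> bool" where
  "parallel_metric M U D g \<longleftrightarrow>
     (\<forall>V X Y. V \<subseteq> U \<and> vector_field M V X \<and> vector_field M V Y \<longrightarrow>
        (\<forall>p\<in>V. \<forall>v\<in>tangent_space M p.
           v (\<lambda>q. g q (X q) (Y q)) = g p (D p v X) (Y p) + g p (X p) (D p v Y)))"

definition parallel_endo ::
    "('a, 'e::euclidean_space) manifold \<Rightarrow> 'a set \<Rightarrow> 'a connection \<Rightarrow> 'a endo \<Rightarrow> bool" where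
  "parallel_endo M U D I \<longleftrightarrow>
     (\<forall>V Y. V \<subseteq> U \<and> vector_field M V Y \<longrightarrow>
        (\<forall>p\<in>V. \<forall>v\<in>tangent_space M p. D p v (\<lambda>q. I q (Y q)) = I p (D p v Y)))"

definition parallel_1form ::
    "('a, 'e::euclidean_space) manifold \<Rightarrow> 'a set \<Rightarrow> 'a connection \<Rightarrow> 'a kform \<Rightarrow> bool" where
  "parallel_1form M U D \<omega> \<longleftrightarrow>
     (\<forall>V Y. V \<subseteq> U \<and> vector_field M V Y \<longrightarrow>
        (\<forall>p\<in>V. \<forall>v\<in>tangent_space M p. v (\<lambda>q. \<omega> q [Y q]) = \<omega> p [D p v Y]))"

definition levi_civita ::
    "('a, 'e::euclidean_space) manifold \<Rightarrow> 'a set \<Rightarrow> 'a bilin \<Rightarrow> 'a connection \<Rightarrow> bool" where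
  "levi_civita M U g D \<longleftrightarrow> linear_connection M U D \<and> parallel_metric M U D g \<and>
     (\<forall>V X Y. V \<subseteq> U \<and> vector_field M V X \<and> vector_field M V Y \<longrightarrow>
        (\<forall>p\<in>V. torsion M D X Y p = 0))"

section \<open>Hypercomplex geometry\<close>

text \<open>Integrability is meant in the sense of complex manifolds: around every point there are
  coordinates of the given smooth structure in which \<open>I\<close> is a constant complex structure \<open>J\<close> on the
  model space. Since all such \<open>J\<close> are conjugate, these are holomorphic coordinates.\<close>

definition complex_structure ::
    "('a, 'e::euclidean_space) manifold \<Rightarrow> 'a set \<Rightarrow> 'a endo \<Rightarrow> bool" where
  "complex_structure M U I \<longleftrightarrow> endo_field M U I \<and>
     (\<forall>p\<in>U. \<forall>v\<in>tangent_space M p. I p (I p v) = - v) \<and>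
     (\<forall>p\<in>U. \<exists>c. is_chart M c \<and> p \<in> fst c \<and> fst c \<subseteq> U \<and>
        (\<exists>J. linear J \<and> (\<forall>e. J (J e) = - e) \<and>
           (\<forall>q\<in>fst c. \<forall>e. I q (coord_vec M c q e) = coord_vec M c q (J e))))"

definition hypercomplex ::
    "('a, 'e::euclidean_space) manifold \<Rightarrow> 'a set \<Rightarrow> 'a endo \<Rightarrow> 'a endo \<Rightarrow> 'a endo \<Rightarrow> bool" where
  "hypercomplex M U I1 I2 I3 \<longleftrightarrow>
     complex_structure M U I1 \<and> complex_structure M U I2 \<and> complex_structure M U I3 \<and>
     (\<forall>p\<in>U. \<forall>v\<in>tangent_space M p.
        I1 p (I2 p v) = I3 p v \<and> I2 p (I1 p v) = - I3 p v)"

definition hyperhermitian ::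
    "('a, 'e::euclidean_space) manifold \<Rightarrow> 'a set \<Rightarrow> 'a bilin \<Rightarrow>
      'a endo \<Rightarrow> 'a endo \<Rightarrow> 'a endo \<Rightarrow> bool" where
  "hyperhermitian M U g I1 I2 I3 \<longleftrightarrow>
     hypercomplex M U I1 I2 I3 \<and> riemannian_metric M U g \<and>
     (\<forall>I\<in>{I1, I2, I3}. \<forall>p\<in>U. \<forall>v\<in>tangent_space M p. \<forall>w\<in>tangent_space M p.
        g p (I p v) (I p w) = g p v w)"

definition hyperkaehler ::
    "('a, 'e::euclidean_space) manifold \<Rightarrow> 'a set \<Rightarrow> 'a bilin \<Rightarrow>
      'a endo \<Rightarrow> 'a endo \<Rightarrow> 'a endo \<Rightarrow> bool" where
  "hyperkaehler M U g I1 I2 I3 \<longleftrightarrow>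
     hyperhermitian M U g I1 I2 I3 \<and>
     (\<exists>D. levi_civita M U g D \<and> (\<forall>I\<in>{I1, I2, I3}. parallel_endo M U D I))"

text \<open>The triples in \<open>\<C>\<close> consist of the open sets \<open>U\<^sub>i\<close> of the cover, the functions \<open>f\<^sub>i\<close> and the
  hyperkaehler metrics \<open>g\<^sub>i\<close>.\<close>

definition lchk_cover ::
    "('a, 'e::euclidean_space) manifold \<Rightarrow> 'a bilin \<Rightarrow> 'a endo \<Rightarrow> 'a endo \<Rightarrow> 'a endo \<Rightarrow>
      ('a set \<times> ('a \<Rightarrow> real) \<times> 'a bilin) set \<Rightarrow> bool" where
  "lchk_cover M g I1 I2 I3 \<C> \<longleftrightarrow>
     (\<Union>(U, f, g')\<in>\<C>. U) = points M \<and>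
     (\<forall>(U, f, g')\<in>\<C>. openin (mtop M) U \<and> smooth_fun M U f \<and>
        hyperkaehler M U g' I1 I2 I3 \<and>
        (\<forall>p\<in>U. \<forall>v\<in>tangent_space M p. \<forall>w\<in>tangent_space M p.
           g p v w = exp (f p) * g' p v w))"

definition lchk_manifold ::
    "('a, 'e::euclidean_space) manifold \<Rightarrow> 'a bilin \<Rightarrow> 'a endo \<Rightarrow> 'a endo \<Rightarrow> 'a endo \<Rightarrow> bool" where
  "lchk_manifold M g I1 I2 I3 \<longleftrightarrow>
     smooth_manifold M \<and> hyperhermitian M (points M) g I1 I2 I3 \<and>
     (\<exists>\<C>. lchk_cover M g I1 I2 I3 \<C>)"

text \<open>\<open>v f\<close> is \<open>df(v)\<close>.\<close>

definition lee_form ::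
    "('a, 'e::euclidean_space) manifold \<Rightarrow> 'a bilin \<Rightarrow> 'a endo \<Rightarrow> 'a endo \<Rightarrow> 'a endo \<Rightarrow>
      'a kform \<Rightarrow> bool" where
  "lee_form M g I1 I2 I3 \<theta> \<longleftrightarrow> is_form M (points M) 1 \<theta> \<and>
     (\<exists>\<C>. lchk_cover M g I1 I2 I3 \<C> \<and>
        (\<forall>(U, f, g')\<in>\<C>. \<forall>p\<in>U. \<forall>v\<in>tangent_space M p. \<theta> p [v] = v f))"

definition hkt_connection ::
    "('a, 'e::euclidean_space) manifold \<Rightarrow> 'a bilin \<Rightarrow> 'a endo \<Rightarrow> 'a endo \<Rightarrow> 'a endo \<Rightarrow>
      'a connection \<Rightarrow> bool" where
  "hkt_connection M g I1 I2 I3 D \<longleftrightarrow>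
     linear_connection M (points M) D \<and> parallel_metric M (points M) D g \<and>
     (\<forall>I\<in>{I1, I2, I3}. parallel_endo M (points M) D I) \<and>
     (\<exists>c. is_form M (points M) 3 c \<and>
        (\<forall>V X Y Z. V \<subseteq> points M \<and>
           vector_field M V X \<and> vector_field M V Y \<and> vector_field M V Z \<longrightarrow>
           (\<forall>p\<in>V. c p [X p, Y p, Z p] = g p (torsion M D X Y p) (Z p))))"

definition hkt_manifold ::
    "('a, 'e::euclidean_space) manifold \<Rightarrow> 'a bilin \<Rightarrow> 'a endo \<Rightarrow> 'a endo \<Rightarrow> 'a endo \<Rightarrow> bool" where
  "hkt_manifold M g I1 I2 I3 \<longleftrightarrow>
     smooth_manifold M \<and> hyperhermitian M (points M) g I1 I2 I3 \<and>
     (\<exists>D. hkt_connection M g I1 I2 I3 D)"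

definition potential_1form ::
    "('a, 'e::euclidean_space) manifold \<Rightarrow> 'a bilin \<Rightarrow> 'a endo \<Rightarrow> 'a endo \<Rightarrow> 'a endo \<Rightarrow>
      'a kform \<Rightarrow> bool" where
  "potential_1form M g I1 I2 I3 \<omega> \<longleftrightarrow> is_form M (points M) 1 \<omega> \<and>
     (let \<omega>1 = form_act I1 \<omega>; \<omega>2 = form_act I2 \<omega>; \<omega>3 = form_act I3 \<omega> in
      \<forall>p\<in>points M. \<forall>v\<in>tangent_space M p. \<forall>w\<in>tangent_space M p.
        fundamental_form g I1 p [v, w] =
          (ext_deriv M \<omega>1 p [v, w] + twisted_deriv M I2 1 \<omega>3 p [v, w]) / 2 \<and>
        fundamental_form g I2 p [v, w] =
          (ext_deriv M \<omega>2 p [v, w] + twisted_deriv M I3 1 \<omega>1 p [v, w]) / 2 \<and>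
        fundamental_form g I3 p [v, w] =
          (ext_deriv M \<omega>3 p [v, w] + twisted_deriv M I1 1 \<omega>2 p [v, w]) / 2)"

end

theory Submission
  imports Defs
begin

text \<open>Let \<open>B\<close> be the dual of \<open>\<theta>\<close> and \<open>F\<^sub>r = g(I\<^sub>r\<cdot>,\<cdot>)\<close>. Locally \<open>g = e\<^sup>f g'\<close> with \<open>g'\<close> hyperkaehler, and
  the Levi-Civita connection \<open>\<nabla>'\<close> of \<open>g'\<close> satisfies
  \<open>\<nabla>'\<^sub>X Y = \<nabla>\<^sub>X Y + (g(X,Y) B - \<theta>(X) Y - \<theta>(Y) X) / 2\<close>. Since \<open>\<nabla>' I\<^sub>r = 0\<close>, this gives \<open>\<nabla> I\<^sub>r\<close> in terms
  of \<open>\<theta>\<close>, \<open>B\<close> and \<open>g\<close>, and since \<open>\<nabla> \<theta> = 0\<close>, it gives \<open>\<nabla> \<theta>\<^sub>r = (\<theta> \<and> \<theta>\<^sub>r - F\<^sub>r) / 2\<close>, hence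
  \<open>d \<theta>\<^sub>r = \<theta> \<and> \<theta>\<^sub>r - F\<^sub>r\<close>. The fundamental forms of the new metric are
  \<open>F\<^sub>1 - (\<theta> \<and> \<theta>\<^sub>1 + \<theta>\<^sub>2 \<and> \<theta>\<^sub>3) / 2\<close> and its cyclic permutations, and \<open>I\<^sub>2\<close> maps \<open>F\<^sub>1\<close> to \<open>- F\<^sub>1\<close> and
  \<open>\<theta> \<and> \<theta>\<^sub>1\<close> to \<open>- \<theta>\<^sub>2 \<and> \<theta>\<^sub>3\<close>; so \<open>- \<theta>\<close> is a potential. The HKT connection is \<open>\<nabla> + A\<close> for an explicit
  tensor \<open>A\<close> built from \<open>\<theta>\<^sub>r\<close>, \<open>I\<^sub>r\<close> and \<open>B\<close>, so that its properties are algebraic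
  identities at each point.\<close>

section \<open>Calculus of \<open>Ck_on\<close>\<close>

lemma Ck_on_subset:
  assumes "Ck_on n T f" "S \<subseteq> T"
  shows "Ck_on n S f"
  using assms by (induction n arbitrary: f) (auto intro: continuous_on_subset)

text \<open>Openness of \<open>S\<close> turns agreement on \<open>S\<close> into agreement near
  each point, so the Frechet derivatives agree as well and the induction passes to them.\<close>

lemma Ck_on_cong:
  assumes "open S" "Ck_on n S f" "\<And>x. x \<in> S \<Longrightarrow> f x = g x"
  shows "Ck_on n S g"
  using assms(2,3)
proof (induction n arbitrary: f g)
  case 0
  then show ?case using continuous_on_cong by fastforce
next
  case (Suc n)
  have d: "f differentiable at x" if "x \<in> S" for x
    using Suc.prems(1) that by simp
  have dg: "g differentiable at x" if x: "x \<in> S" for x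
  proof -
    obtain f' where "(f has_derivative f') (at x)"
      using d[OF x] unfolding differentiable_def by blast
    then show ?thesis
      using has_derivative_transform_within_open[OF _ assms(1) x, of f f' UNIV g] Suc.prems(2)
      unfolding differentiable_def by auto
  qed
  have eq: "frechet_derivative f (at x) = frechet_derivative g (at x)" if "x \<in> S" for x
    using frechet_derivative_transform_within_open[OF d[OF that] assms(1) that] Suc.prems(2) by blast
  have "Ck_on n S (\<lambda>x. frechet_derivative g (at x) e)" for e
    by (rule Suc.IH[where f = "\<lambda>x. frechet_derivative f (at x) e"]) (use Suc.prems(1) eq in auto)
  with dg show ?case by simp
qed

lemma Ck_on_Union:
  assumes "\<And>x. x \<in> S \<Longrightarrow> \<exists>T. open T \<and> x \<in> T \<and> T \<subseteq> S \<and> Ck_on n T f"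
  shows "Ck_on n S f"
  using assms
proof (induction n arbitrary: f)
  case 0
  have "isCont f x" if x: "x \<in> S" for x
    using 0[OF x] by (auto simp: continuous_on_eq_continuous_at)
  then show ?case by (simp add: continuous_at_imp_continuous_on)
next
  case (Suc n)
  have "f differentiable at x" if "x \<in> S" for x
    using Suc.prems[OF that] by auto
  moreover have "Ck_on n S (\<lambda>x. frechet_derivative f (at x) e)" for e
  proof (rule Suc.IH)
    show "\<exists>T. open T \<and> x \<in> T \<and> T \<subseteq> S \<and> Ck_on n T (\<lambda>x. frechet_derivative f (at x) e)"
      if x: "x \<in> S" for x
    proof -
      obtain T where "open T" "x \<in> T" "T \<subseteq> S" "Ck_on (Suc n) T f"
        using Suc.prems[OF x] by (elim exE conjE)
      then show ?thesis by (intro exI[of _ T]) simp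
    qed
  qed
  ultimately show ?case by simp
qed

text \<open>\<open>Ck_on (Suc n)\<close> does not literally contain \<open>Ck_on n\<close>: at order
  0 continuity comes from differentiability, and the higher orders pass through the
  derivatives.\<close>

lemma Ck_on_Suc_imp: "Ck_on (Suc n) S f \<Longrightarrow> Ck_on n S f"
proof (induction n arbitrary: f)
  case 0
  then show ?case
    by (auto intro!: continuous_at_imp_continuous_on differentiable_imp_continuous_within)
qed auto

lemma Ck_on_const: "Ck_on n S (\<lambda>x. c)"
  by (induction n arbitrary: c) simp_all

lemma Ck_on_add:
  assumes "open S" "Ck_on n S f" "Ck_on n S g"
  shows "Ck_on n S (\<lambda>x. f x + g x)"
  using assms(2,3)
proof (induction n arbitrary: f g)
  case (Suc n)
  have "Ck_on n S (\<lambda>x. frechet_derivative (\<lambda>x. f x + g x) (at x) e)" for e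
    by (rule Ck_on_cong[OF assms(1), where f = "\<lambda>x. frechet_derivative f (at x) e + frechet_derivative g (at x) e"])
      (use Suc in \<open>auto intro!: fun_cong[OF frechet_derivative_at] has_derivative_add
        simp: frechet_derivative_works[symmetric]\<close>)
  with Suc.prems show ?case by (simp add: differentiable_add)
qed (simp add: continuous_on_add)

lemma Ck_on_mult:
  fixes f g :: "'e::euclidean_space \<Rightarrow> real"
  assumes "open S" "Ck_on n S f" "Ck_on n S g"
  shows "Ck_on n S (\<lambda>x. f x * g x)"
  using assms(2,3)
proof (induction n arbitrary: f g)
  case (Suc n)
  have "Ck_on n S (\<lambda>x. frechet_derivative (\<lambda>x. f x * g x) (at x) e)" for e
  proof (rule Ck_on_cong[OF assms(1), where f =
      "\<lambda>x. f x * frechet_derivative g (at x) e + frechet_derivative f (at x) e * g x"])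
    show "Ck_on n S (\<lambda>x. f x * frechet_derivative g (at x) e + frechet_derivative f (at x) e * g x)"
      using Suc Ck_on_Suc_imp[of n S f] Ck_on_Suc_imp[of n S g]
      by (intro Ck_on_add[OF assms(1)] Suc.IH) auto
    show "f x * frechet_derivative g (at x) e + frechet_derivative f (at x) e * g x =
      frechet_derivative (\<lambda>x. f x * g x) (at x) e" if "x \<in> S" for x
      using Suc.prems that
      by (intro fun_cong[OF frechet_derivative_at] has_derivative_mult)
        (auto simp: frechet_derivative_works[symmetric])
  qed
  with Suc.prems show ?case by (simp add: differentiable_mult)
qed (simp add: continuous_on_mult)

lemma Ck_on_linear_compose:
  assumes "open S" "Ck_on n S f" "bounded_linear L"
  shows "Ck_on n S (\<lambda>x. L (f x))"
  using assms(2)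
proof (induction n arbitrary: f)
  case 0
  then show ?case using assms(3) by (simp add: bounded_linear.continuous_on)
next
  case (Suc n)
  have hd: "((\<lambda>x. L (f x)) has_derivative (\<lambda>e. L (frechet_derivative f (at x) e))) (at x)"
    if "x \<in> S" for x
    using Suc.prems that
    by (intro bounded_linear.has_derivative[OF assms(3)]) (auto simp: frechet_derivative_works[symmetric])
  have "Ck_on n S (\<lambda>x. frechet_derivative (\<lambda>x. L (f x)) (at x) e)" for e
    by (rule Ck_on_cong[OF assms(1), where f = "\<lambda>x. L (frechet_derivative f (at x) e)"])
      (use Suc fun_cong[OF frechet_derivative_at[OF hd]] in auto)
  with hd show ?case by (auto simp: differentiable_def)
qed

lemma Ck_on_sum:
  assumes "open S" "finite B" "\<And>b. b \<in> B \<Longrightarrow> Ck_on n S (f b)"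
  shows "Ck_on n S (\<lambda>x. \<Sum>b\<in>B. f b x)"
  using assms(2,3) by (induction) (auto intro: Ck_on_const Ck_on_add[OF assms(1)])

text \<open>The derivative contains \<open>inverse (f x)\<close> again, but only to one order less,
  which the induction hypothesis supplies. The same pattern works for \<open>exp\<close>.\<close>

lemma Ck_on_inverse:
  fixes f :: "'e::euclidean_space \<Rightarrow> real"
  assumes "open S" "Ck_on n S f" "\<And>x. x \<in> S \<Longrightarrow> f x \<noteq> 0"
  shows "Ck_on n S (\<lambda>x. inverse (f x))"
  using assms(2,3)
proof (induction n)
  case 0
  then show ?case by (simp add: continuous_on_inverse)
next
  case (Suc n)
  have hd: "((\<lambda>x. inverse (f x)) has_derivative
      (\<lambda>e. - (inverse (f x) * frechet_derivative f (at x) e * inverse (f x)))) (at x)" if "x \<in> S" for x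
    using Suc.prems that
    by (intro Deriv.has_derivative_inverse) (auto simp: frechet_derivative_works[symmetric])
  have Ck: "Ck_on n S (\<lambda>x. - 1 * (inverse (f x) * frechet_derivative f (at x) e * inverse (f x)))" for e
    using Suc Ck_on_Suc_imp[of n S f]
    by (intro Ck_on_mult[OF assms(1)] Ck_on_const) auto
  have "Ck_on n S (\<lambda>x. frechet_derivative (\<lambda>x. inverse (f x)) (at x) e)" for e
    by (rule Ck_on_cong[OF assms(1) Ck[of e]])
      (use fun_cong[OF frechet_derivative_at[OF hd]] in auto)
  with hd show ?case by (auto simp: differentiable_def)
qed

lemma Ck_on_exp:
  fixes f :: "'e::euclidean_space \<Rightarrow> real"
  assumes "open S" "Ck_on n S f"
  shows "Ck_on n S (\<lambda>x. exp (f x))"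
  using assms(2)
proof (induction n)
  case 0
  then show ?case by (simp add: continuous_on_exp)
next
  case (Suc n)
  have hd: "((\<lambda>x. exp (f x)) has_derivative
      (\<lambda>e. exp (f x) * frechet_derivative f (at x) e)) (at x)" if "x \<in> S" for x
    using Suc.prems that
    by (auto intro!: derivative_eq_intros simp: frechet_derivative_works[symmetric])
  have Ck: "Ck_on n S (\<lambda>x. exp (f x) * frechet_derivative f (at x) e)" for e
    using Suc Ck_on_Suc_imp[of n S f] by (intro Ck_on_mult[OF assms(1)]) auto
  have "Ck_on n S (\<lambda>x. frechet_derivative (\<lambda>x. exp (f x)) (at x) e)" for e
    by (rule Ck_on_cong[OF assms(1) Ck[of e]])
      (use fun_cong[OF frechet_derivative_at[OF hd]] in auto)
  with hd show ?case by (auto simp: differentiable_def)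
qed

lemma Ck_on_compose:
  fixes f :: "'e::euclidean_space \<Rightarrow> real" and \<phi> :: "'d::euclidean_space \<Rightarrow> 'e"
  assumes "open S" "\<phi> ` S \<subseteq> T" "Ck_on n T f" "Ck_on n S \<phi>"
  shows "Ck_on n S (f \<circ> \<phi>)"
  using assms(3,4)
proof (induction n arbitrary: f)
  case 0
  then show ?case using assms(2) by (auto simp: o_def intro: continuous_on_compose2)
next
  case (Suc n)
  \<comment> \<open>The chain rule in coordinates: expanding the inner derivative along
    \<open>Basis\<close> leaves a finite sum of products of real functions, to which
    \<open>Ck_on_sum\<close> and \<open>Ck_on_mult\<close> apply.\<close>
  let ?D = "\<lambda>x e. \<Sum>b\<in>Basis. (frechet_derivative \<phi> (at x) e \<bullet> b) * frechet_derivative f (at (\<phi> x)) b"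
  have d\<phi>: "\<phi> differentiable at x" "f differentiable at (\<phi> x)" if "x \<in> S" for x
    using Suc.prems assms(2) that by auto
  have eq: "frechet_derivative (f \<circ> \<phi>) (at x) e = ?D x e" if "x \<in> S" for x e
  proof -
    have "linear (frechet_derivative f (at (\<phi> x)))"
      by (simp add: d\<phi>(2) linear_frechet_derivative that)
    then have "frechet_derivative f (at (\<phi> x)) (\<Sum>b\<in>Basis. (frechet_derivative \<phi> (at x) e \<bullet> b) *\<^sub>R b) = ?D x e"
      by (simp add: linear_sum linear_scale)
    then show ?thesis
      using frechet_derivative_compose[OF d\<phi>[OF that]] by (simp add: euclidean_representation)
  qed
  have comp: "Ck_on n S (\<lambda>x. frechet_derivative f (at (\<phi> x)) b)" for b
    using Suc.IH[of "\<lambda>y. frechet_derivative f (at y) b"] Suc.prems Ck_on_Suc_imp[of n S \<phi>]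
    by (auto simp: o_def)
  have inner: "Ck_on n S (\<lambda>x. frechet_derivative \<phi> (at x) e \<bullet> b)" for e b
    using Ck_on_linear_compose[OF assms(1) _ bounded_linear_inner_left[of b]] Suc.prems(2) by auto
  have Ck: "Ck_on n S (\<lambda>x. ?D x e)" for e
    by (intro Ck_on_sum[OF assms(1) finite_Basis] Ck_on_mult[OF assms(1)] comp inner)
  have "Ck_on n S (\<lambda>x. frechet_derivative (f \<circ> \<phi>) (at x) e)" for e
    by (rule Ck_on_cong[OF assms(1) Ck]) (simp add: eq)
  with d\<phi> show ?case by (auto simp del: o_apply simp: differentiable_chain_at comp_def[symmetric])
qed

section \<open>Smooth maps and the symmetry of second derivatives\<close>

lemma smooth_on_subset: "smooth_on T f \<Longrightarrow> S \<subseteq> T \<Longrightarrow> smooth_on S f"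
  unfolding smooth_on_def by (blast intro: Ck_on_subset)

lemma smooth_on_cong:
  assumes "open S" "smooth_on S f" "\<And>x. x \<in> S \<Longrightarrow> f x = g x"
  shows "smooth_on S g"
  using Ck_on_cong[OF assms(1), of _ f g] assms(2,3) unfolding smooth_on_def by blast

lemma smooth_on_frechet_derivative:
  assumes "smooth_on S f"
  shows "smooth_on S (\<lambda>x. frechet_derivative f (at x) e)"
  unfolding smooth_on_def
proof
  fix n
  have "Ck_on (Suc n) S f" using assms smooth_on_def by blast
  then show "Ck_on n S (\<lambda>x. frechet_derivative f (at x) e)" by simp
qed

lemma smooth_on_imp_differentiable: "smooth_on S f \<Longrightarrow> x \<in> S \<Longrightarrow> f differentiable at x"
  unfolding smooth_on_def using Ck_on.simps(2) by blast

lemma smooth_on_imp_continuous_on: "smooth_on S f \<Longrightarrow> continuous_on S f"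
  unfolding smooth_on_def using Ck_on.simps(1) by blast

text \<open>Both mixed derivatives are limits of the same second difference quotient.\<close>

lemma second_difference:
  fixes f :: "'e::euclidean_space \<Rightarrow> real"
  assumes "smooth_on S f" "ball x r \<subseteq> S" "h > 0" "h * (norm u + norm w) < r"
  obtains y where "norm (y - x) \<le> h * (norm u + norm w)" and
    "f (x + h *\<^sub>R u + h *\<^sub>R w) - f (x + h *\<^sub>R u) - f (x + h *\<^sub>R w) + f x =
      h * h * frechet_derivative (\<lambda>z. frechet_derivative f (at z) u) (at y) w"
proof -
  define f1 where "f1 z = frechet_derivative f (at z) u" for z
  have near: "x + s *\<^sub>R u + t *\<^sub>R w \<in> S \<and> norm (x + s *\<^sub>R u + t *\<^sub>R w - x) \<le> h * (norm u + norm w)"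
    if "0 \<le> s" "s \<le> h" "0 \<le> t" "t \<le> h" for s t
  proof -
    have "norm (s *\<^sub>R u + t *\<^sub>R w) \<le> s * norm u + t * norm w"
      using norm_triangle_ineq[of "s *\<^sub>R u" "t *\<^sub>R w"] that by simp
    also have "\<dots> \<le> h * norm u + h * norm w"
      using that by (intro add_mono mult_right_mono) auto
    finally have *: "norm (s *\<^sub>R u + t *\<^sub>R w) \<le> h * (norm u + norm w)"
      by (simp add: algebra_simps)
    with assms(4) have "x + s *\<^sub>R u + t *\<^sub>R w \<in> ball x r"
      by (simp add: dist_norm norm_minus_commute algebra_simps)
    with * assms(2) show ?thesis by (auto simp: algebra_simps)
  qed
  have df: "(f has_derivative frechet_derivative f (at z)) (at z)" if "z \<in> S" for z
    using smooth_on_imp_differentiable[OF assms(1) that] frechet_derivative_works by blast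
  have df1: "(f1 has_derivative frechet_derivative f1 (at z)) (at z)" if "z \<in> S" for z
    using smooth_on_imp_differentiable[OF smooth_on_frechet_derivative[OF assms(1)] that]
      frechet_derivative_works unfolding f1_def by blast
  \<comment> \<open>The second difference is \<open>\<phi> h - \<phi> 0\<close>. One mean value step
    in \<open>s\<close> produces the derivative \<open>f1\<close> along \<open>u\<close>; a second
    one in \<open>t\<close> produces the derivative of \<open>f1\<close> along
    \<open>w\<close>.\<close>
  define \<phi> where "\<phi> s = f (x + s *\<^sub>R u + h *\<^sub>R w) - f (x + s *\<^sub>R u)" for s
  have d1: "((\<lambda>s. f (x + s *\<^sub>R u + t *\<^sub>R w)) has_real_derivative f1 (x + s *\<^sub>R u + t *\<^sub>R w)) (at s)"
    if "0 \<le> s" "s \<le> h" "0 \<le> t" "t \<le> h" for s t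
  proof -
    have "((\<lambda>s. f (x + s *\<^sub>R u + t *\<^sub>R w)) has_derivative
        (\<lambda>a. frechet_derivative f (at (x + s *\<^sub>R u + t *\<^sub>R w)) (a *\<^sub>R u))) (at s)"
      by (rule has_derivative_compose[OF _ df, of "\<lambda>s. x + s *\<^sub>R u + t *\<^sub>R w"])
        (use near[OF that] in \<open>auto intro!: derivative_eq_intros\<close>)
    moreover have "linear (frechet_derivative f (at (x + s *\<^sub>R u + t *\<^sub>R w)))"
      using df near[OF that] has_derivative_linear by blast
    ultimately show ?thesis
      by (simp add: has_field_derivative_def f1_def linear_scale mult_commute_abs)
  qed
  have d2: "((\<lambda>t. f1 (x + s *\<^sub>R u + t *\<^sub>R w)) has_real_derivative
      frechet_derivative f1 (at (x + s *\<^sub>R u + t *\<^sub>R w)) w) (at t)"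
    if "0 \<le> s" "s \<le> h" "0 \<le> t" "t \<le> h" for s t
  proof -
    have "((\<lambda>t. f1 (x + s *\<^sub>R u + t *\<^sub>R w)) has_derivative
        (\<lambda>a. frechet_derivative f1 (at (x + s *\<^sub>R u + t *\<^sub>R w)) (a *\<^sub>R w))) (at t)"
      by (rule has_derivative_compose[OF _ df1, of "\<lambda>t. x + s *\<^sub>R u + t *\<^sub>R w"])
        (use near[OF that] in \<open>auto intro!: derivative_eq_intros\<close>)
    moreover have "linear (frechet_derivative f1 (at (x + s *\<^sub>R u + t *\<^sub>R w)))"
      using df1 near[OF that] has_derivative_linear by blast
    ultimately show ?thesis
      by (simp add: has_field_derivative_def linear_scale mult_commute_abs)
  qed
  have "(\<phi> has_real_derivative f1 (x + s *\<^sub>R u + h *\<^sub>R w) - f1 (x + s *\<^sub>R u)) (at s)"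
    if "0 \<le> s" "s \<le> h" for s
    unfolding \<phi>_def using d1[OF that, of h] d1[OF that, of 0] assms(3) by (intro DERIV_diff) auto
  then obtain s where s: "0 < s" "s < h" "\<phi> h - \<phi> 0 = (h - 0) * (f1 (x + s *\<^sub>R u + h *\<^sub>R w) - f1 (x + s *\<^sub>R u))"
    using MVT2[OF assms(3), of \<phi> "\<lambda>s. f1 (x + s *\<^sub>R u + h *\<^sub>R w) - f1 (x + s *\<^sub>R u)"] by auto
  then obtain t where t: "0 < t" "t < h" "f1 (x + s *\<^sub>R u + h *\<^sub>R w) - f1 (x + s *\<^sub>R u + 0 *\<^sub>R w) =
      (h - 0) * frechet_derivative f1 (at (x + s *\<^sub>R u + t *\<^sub>R w)) w"
    using MVT2[OF assms(3), of "\<lambda>t. f1 (x + s *\<^sub>R u + t *\<^sub>R w)"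
        "\<lambda>t. frechet_derivative f1 (at (x + s *\<^sub>R u + t *\<^sub>R w)) w"] d2[of s] by auto
  show thesis
    by (rule that[of "x + s *\<^sub>R u + t *\<^sub>R w"]) (use near[of s t] s t in \<open>auto simp: \<phi>_def f1_def[abs_def]\<close>)
qed

lemma symmetric_frechet_derivative:
  fixes f :: "'e::euclidean_space \<Rightarrow> real"
  assumes "open S" "smooth_on S f" "x \<in> S"
  shows "frechet_derivative (\<lambda>z. frechet_derivative f (at z) u) (at x) w =
    frechet_derivative (\<lambda>z. frechet_derivative f (at z) w) (at x) u" (is "?A u w x = ?A w u x")
proof -
  obtain r where r: "r > 0" "ball x r \<subseteq> S" using assms open_contains_ball by blast
  have sm: "smooth_on S (?A u w)" for u w
    by (intro smooth_on_frechet_derivative assms(2))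
  have "\<bar>?A u w x - ?A w u x\<bar> \<le> e" if "e > 0" for e
  proof -
    have "\<exists>d>0. \<forall>y\<in>S. dist y x < d \<longrightarrow> dist (?A u w y) (?A u w x) < e / 2" for u w
      using smooth_on_imp_continuous_on[OF sm[of u w]] assms(3) that
      unfolding continuous_on_iff by (meson half_gt_zero)
    then obtain d1 d2 where d: "d1 > 0" "d2 > 0"
      "\<And>y. y \<in> S \<Longrightarrow> dist y x < d1 \<Longrightarrow> dist (?A u w y) (?A u w x) < e / 2"
      "\<And>y. y \<in> S \<Longrightarrow> dist y x < d2 \<Longrightarrow> dist (?A w u y) (?A w u x) < e / 2"
      by meson
    \<comment> \<open>The summand 1 keeps \<open>N\<close> positive when \<open>u\<close> and
      \<open>w\<close> both vanish. With the \<open>h\<close> below, the intermediate points stay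
      inside the ball and within both continuity radii.\<close>
    define N where "N = norm u + norm w + 1"
    have N: "N > 0" unfolding N_def by (smt (verit) norm_ge_zero)
    define h where "h = min r (min d1 d2) / (2 * N)"
    have h: "h > 0" unfolding h_def using r d N by auto
    have "h * N = min r (min d1 d2) / 2"
      unfolding h_def using N by (simp add: field_simps)
    then have "h * N < min r (min d1 d2)" using r d by auto
    moreover have "h * (norm u + norm w) \<le> h * N"
      using h unfolding N_def by (intro mult_left_mono) auto
    ultimately have hr: "h * (norm u + norm w) < r" "h * (norm u + norm w) < d1" "h * (norm u + norm w) < d2"
      by auto
    obtain y where y: "norm (y - x) \<le> h * (norm u + norm w)"
        "f (x + h *\<^sub>R u + h *\<^sub>R w) - f (x + h *\<^sub>R u) - f (x + h *\<^sub>R w) + f x = h * h * ?A u w y"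
      by (rule second_difference[OF assms(2) r(2) h hr(1)])
    obtain z where z: "norm (z - x) \<le> h * (norm w + norm u)"
        "f (x + h *\<^sub>R w + h *\<^sub>R u) - f (x + h *\<^sub>R w) - f (x + h *\<^sub>R u) + f x = h * h * ?A w u z"
      by (rule second_difference[OF assms(2) r(2) h, of w u]) (use hr in \<open>auto simp: algebra_simps\<close>)
    \<comment> \<open>The second difference is symmetric in \<open>u\<close> and \<open>w\<close>,
      so both mean value points give the same number.\<close>
    have "h * h * ?A u w y = h * h * ?A w u z"
      using y(2) z(2) by (simp add: algebra_simps)
    then have "?A u w y = ?A w u z" using h by simp
    moreover have "dist y x < d1" "dist z x < d2" "dist y x < r" "dist z x < r"
      using y(1) z(1) hr by (auto simp: dist_norm add.commute)
    moreover have "y \<in> S" "z \<in> S" using calculation r(2) by (auto simp: dist_commute subset_iff)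
    ultimately show ?thesis using d(3)[of y] d(4)[of z] unfolding dist_real_def by linarith
  qed
  then show ?thesis by (metis field_le_epsilon abs_le_zero_iff add_0 eq_iff_diff_eq_0)
qed

section \<open>Smooth functions and tangent vectors\<close>

locale smooth_mfd =
  fixes M :: "('a, 'e::euclidean_space) manifold"
  assumes smooth_manifold: "smooth_manifold M"
begin

abbreviation T where "T \<equiv> tangent_space M"

section \<open>Charts of the atlas\<close>

lemma atlas_is_chart: "c \<in> atlas M \<Longrightarrow> is_chart M c"
  using smooth_manifold unfolding smooth_manifold_def by blast

lemma chart_openin: "c \<in> atlas M \<Longrightarrow> openin (mtop M) (fst c)"
  using atlas_is_chart unfolding is_chart_def by blast

lemma chart_at:
  assumes "p \<in> points M"
  shows "chart_at M p \<in> atlas M" "p \<in> fst (chart_at M p)"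
proof -
  have "\<exists>c. c \<in> atlas M \<and> p \<in> fst c"
    using smooth_manifold assms unfolding smooth_manifold_def by blast
  from someI_ex[OF this] show "chart_at M p \<in> atlas M" "p \<in> fst (chart_at M p)"
    unfolding chart_at_def by blast+
qed

lemma chart_image_open:
  assumes c: "c \<in> atlas M" and V: "openin (mtop M) V"
  shows "open (snd c ` (fst c \<inter> V))"
proof -
  have *: "open (snd c ` fst c)"
    "homeomorphic_map (subtopology (mtop M) (fst c)) (top_of_set (snd c ` fst c)) (snd c)"
    using atlas_is_chart[OF c] unfolding is_chart_def by auto
  have "openin (subtopology (mtop M) (fst c)) (fst c \<inter> V)"
    using V by (simp add: openin_subtopology_Int2)
  with *(2) have "openin (top_of_set (snd c ` fst c)) (snd c ` (fst c \<inter> V))"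
    using homeomorphic_imp_open_map open_map_def by blast
  with *(1) show ?thesis using openin_open_trans by blast
qed

lemma chart_inv_chart:
  assumes c: "c \<in> atlas M" and p: "p \<in> fst c"
  shows "chart_inv c (snd c p) = p"
proof -
  have "homeomorphic_map (subtopology (mtop M) (fst c)) (top_of_set (snd c ` fst c)) (snd c)"
    using atlas_is_chart[OF c] unfolding is_chart_def by auto
  then have "inj_on (snd c) (topspace (subtopology (mtop M) (fst c)))"
    by (rule homeomorphic_imp_injective_map)
  then have "inj_on (snd c) (fst c)"
    using openin_subset[OF chart_openin[OF c]] by (simp add: Int_absorb1)
  with p show ?thesis by (simp add: chart_inv_def)
qed

lemma transition_smooth:
  assumes "c \<in> atlas M" "d \<in> atlas M"
  shows "smooth_on (snd c ` (fst c \<inter> fst d)) (snd d \<circ> chart_inv c)"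
  using atlas_is_chart[OF assms(1)] assms(2) unfolding is_chart_def smooth_transition_def by blast

section \<open>Smooth functions on open subsets of the manifold\<close>

lemma smooth_fun_openin: "smooth_fun M V f \<Longrightarrow> openin (mtop M) V"
  by (simp add: smooth_fun_def)

lemma smooth_fun_subset:
  assumes "smooth_fun M V f" "openin (mtop M) W" "W \<subseteq> V"
  shows "smooth_fun M W f"
  using assms unfolding smooth_fun_def by (meson Int_mono image_mono order_refl smooth_on_subset)

lemma smooth_fun_cong:
  assumes "smooth_fun M V f" "\<And>q. q \<in> V \<Longrightarrow> f q = g q"
  shows "smooth_fun M V g"
  unfolding smooth_fun_def
proof (intro conjI ballI)
  show V: "openin (mtop M) V" using assms(1) by (rule smooth_fun_openin)
  fix c assume c: "c \<in> atlas M"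
  show "smooth_on (snd c ` (fst c \<inter> V)) (g \<circ> chart_inv c)"
  proof (rule smooth_on_cong)
    show "open (snd c ` (fst c \<inter> V))" by (rule chart_image_open[OF c V])
    show "smooth_on (snd c ` (fst c \<inter> V)) (f \<circ> chart_inv c)"
      using assms(1) c by (simp add: smooth_fun_def)
  qed (use assms(2) in \<open>auto simp: chart_inv_chart[OF c]\<close>)
qed

lemma smooth_fun_local:
  assumes "\<And>p. p \<in> V \<Longrightarrow> \<exists>W. p \<in> W \<and> W \<subseteq> V \<and> smooth_fun M W f"
  shows "smooth_fun M V f"
  unfolding smooth_fun_def
proof (intro conjI ballI)
  show V: "openin (mtop M) V"
    using assms smooth_fun_openin by (subst openin_subopen) meson
  fix c assume c: "c \<in> atlas M"
  show "smooth_on (snd c ` (fst c \<inter> V)) (f \<circ> chart_inv c)"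
    unfolding smooth_on_def
  proof (intro allI Ck_on_Union)
    fix n x assume "x \<in> snd c ` (fst c \<inter> V)"
    then obtain p where p: "p \<in> fst c" "p \<in> V" "x = snd c p" by auto
    obtain W where W: "p \<in> W" "W \<subseteq> V" "smooth_fun M W f" using assms[OF p(2)] by auto
    show "\<exists>S. open S \<and> x \<in> S \<and> S \<subseteq> snd c ` (fst c \<inter> V) \<and> Ck_on n S (f \<circ> chart_inv c)"
    proof (intro exI conjI)
      show "open (snd c ` (fst c \<inter> W))"
        by (rule chart_image_open[OF c smooth_fun_openin[OF W(3)]])
      show "Ck_on n (snd c ` (fst c \<inter> W)) (f \<circ> chart_inv c)"
        using W(3) c by (simp add: smooth_fun_def smooth_on_def)
    qed (use p W in auto)
  qed
qed

lemma smooth_funD: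
  "smooth_fun M V f \<Longrightarrow> c \<in> atlas M \<Longrightarrow> Ck_on n (snd c ` (fst c \<inter> V)) (\<lambda>x. f (chart_inv c x))"
  unfolding smooth_fun_def smooth_on_def by (simp add: o_def)

lemma smooth_funI:
  assumes "openin (mtop M) V"
    and "\<And>c n. c \<in> atlas M \<Longrightarrow> open (snd c ` (fst c \<inter> V)) \<Longrightarrow>
      Ck_on n (snd c ` (fst c \<inter> V)) (\<lambda>x. f (chart_inv c x))"
  shows "smooth_fun M V f"
  using assms chart_image_open unfolding smooth_fun_def smooth_on_def by (simp add: o_def)

lemma smooth_fun_const: "openin (mtop M) V \<Longrightarrow> smooth_fun M V (\<lambda>q. r)"
  by (rule smooth_funI) (auto intro: Ck_on_const)

lemma smooth_fun_add:
  assumes "smooth_fun M V f" "smooth_fun M V g"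
  shows "smooth_fun M V (\<lambda>q. f q + g q)"
  by (rule smooth_funI) (use assms in \<open>auto intro: Ck_on_add smooth_funD smooth_fun_openin\<close>)

lemma smooth_fun_mult:
  assumes "smooth_fun M V f" "smooth_fun M V g"
  shows "smooth_fun M V (\<lambda>q. f q * g q)"
  by (rule smooth_funI) (use assms in \<open>auto intro: Ck_on_mult smooth_funD smooth_fun_openin\<close>)

lemma smooth_fun_cmult:
  assumes "smooth_fun M V f"
  shows "smooth_fun M V (\<lambda>q. r * f q)"
  using smooth_fun_mult[OF smooth_fun_const assms] assms smooth_fun_openin by blast

lemma smooth_fun_minus:
  assumes "smooth_fun M V f"
  shows "smooth_fun M V (\<lambda>q. - f q)"
  using smooth_fun_cmult[OF assms, of "- 1"] by simp

lemma smooth_fun_diff: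
  assumes "smooth_fun M V f" "smooth_fun M V g"
  shows "smooth_fun M V (\<lambda>q. f q - g q)"
  using smooth_fun_add[OF assms(1) smooth_fun_minus[OF assms(2)]] by simp

lemma smooth_fun_inverse:
  assumes "smooth_fun M V f" "\<And>q. q \<in> V \<Longrightarrow> f q \<noteq> 0"
  shows "smooth_fun M V (\<lambda>q. inverse (f q))"
proof (rule smooth_funI)
  show "openin (mtop M) V" using assms(1) by (rule smooth_fun_openin)
  fix c n assume c: "c \<in> atlas M" "open (snd c ` (fst c \<inter> V))"
  then show "Ck_on n (snd c ` (fst c \<inter> V)) (\<lambda>x. inverse (f (chart_inv c x)))"
    using assms by (intro Ck_on_inverse smooth_funD) (auto simp: chart_inv_chart)
qed

lemma smooth_fun_exp:
  assumes "smooth_fun M V f"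
  shows "smooth_fun M V (\<lambda>q. exp (f q))"
  by (rule smooth_funI) (use assms in \<open>auto intro: Ck_on_exp smooth_funD smooth_fun_openin\<close>)

lemma smooth_fun_differentiable:
  assumes "smooth_fun M V f" "c \<in> atlas M" "p \<in> fst c" "p \<in> V"
  shows "f \<circ> chart_inv c differentiable at (snd c p)"
  using assms unfolding smooth_fun_def by (blast intro: smooth_on_imp_differentiable)

section \<open>Germs of smooth functions, tangent vectors and their derivation rules\<close>

lemma smooth_nearI: "smooth_fun M V f \<Longrightarrow> p \<in> V \<Longrightarrow> smooth_near M p f"
  unfolding smooth_near_def by blast

text \<open>Tangent vectors branch on \<open>smooth_near\<close>, so their locality needs the
  locality of this test.\<close>

lemma smooth_near_cong:
  assumes "openin (mtop M) V" "p \<in> V" "\<And>q. q \<in> V \<Longrightarrow> f q = g q"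
  shows "smooth_near M p f \<longleftrightarrow> smooth_near M p g"
proof -
  have "smooth_near M p g" if fg: "smooth_near M p f" "\<And>q. q \<in> V \<Longrightarrow> f q = g q" for f g
  proof -
    obtain W where W: "p \<in> W" "smooth_fun M W f" using fg unfolding smooth_near_def by blast
    then have "smooth_fun M (W \<inter> V) f"
      using assms(1) by (intro smooth_fun_subset[OF W(2)]) (auto dest: smooth_fun_openin)
    then have "smooth_fun M (W \<inter> V) g" using fg(2) by (auto intro: smooth_fun_cong)
    with W assms(2) show ?thesis by (auto intro: smooth_nearI)
  qed
  from this[of f g] this[of g f] show ?thesis using assms(3) by auto
qed

lemma smooth_near_differentiable:
  assumes "smooth_near M p f" "c \<in> atlas M" "p \<in> fst c"
  shows "f \<circ> chart_inv c differentiable at (snd c p)"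
  using assms smooth_fun_differentiable unfolding smooth_near_def by blast

text \<open>The chain rule through the transition map. It allows every tangent vector at
  \<open>p\<close> to be written in one fixed chart.\<close>

lemma coord_vec_change:
  assumes c: "c \<in> atlas M" "p \<in> fst c" and d: "d \<in> atlas M" "p \<in> fst d"
  shows "coord_vec M d p e =
    coord_vec M c p (frechet_derivative (snd c \<circ> chart_inv d) (at (snd d p)) e)"
proof
  fix f
  show "coord_vec M d p e f =
    coord_vec M c p (frechet_derivative (snd c \<circ> chart_inv d) (at (snd d p)) e) f"
  proof (cases "smooth_near M p f")
    case True
    let ?S = "snd d ` (fst d \<inter> fst c)"
    have S: "open ?S" "snd d p \<in> ?S" using chart_image_open[OF d(1) chart_openin[OF c(1)]] c d by auto
    have "snd c \<circ> chart_inv d differentiable at (snd d p)"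
      by (rule smooth_on_imp_differentiable[OF transition_smooth[OF d(1) c(1)] S(2)])
    moreover have "f \<circ> chart_inv c differentiable at ((snd c \<circ> chart_inv d) (snd d p))"
      using smooth_near_differentiable[OF True c] by (simp add: chart_inv_chart[OF d])
    ultimately have "frechet_derivative ((f \<circ> chart_inv c) \<circ> (snd c \<circ> chart_inv d)) (at (snd d p)) =
      frechet_derivative (f \<circ> chart_inv c) (at (snd c p)) \<circ>
        frechet_derivative (snd c \<circ> chart_inv d) (at (snd d p))"
      using frechet_derivative_compose chart_inv_chart[OF d] by fastforce
    moreover have "frechet_derivative (f \<circ> chart_inv d) (at (snd d p)) =
      frechet_derivative ((f \<circ> chart_inv c) \<circ> (snd c \<circ> chart_inv d)) (at (snd d p))"
      by (rule frechet_derivative_transform_within_open[OF smooth_near_differentiable[OF True d] S])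
        (auto simp: chart_inv_chart c d)
    ultimately show ?thesis using True by (simp add: coord_vec_def)
  qed (simp add: coord_vec_def)
qed

lemma tangent_spaceI: "c \<in> atlas M \<Longrightarrow> p \<in> fst c \<Longrightarrow> coord_vec M c p e \<in> T p"
  unfolding tangent_space_def by blast

lemma tangent_spaceE:
  assumes "v \<in> T p" "c \<in> atlas M" "p \<in> fst c"
  obtains e where "v = coord_vec M c p e"
  using assms coord_vec_change[OF assms(2,3)] unfolding tangent_space_def by blast

lemma coord_vec_linear:
  assumes c: "c \<in> atlas M" "p \<in> fst c"
  shows "coord_vec M c p (a *\<^sub>R e + b *\<^sub>R e') = a *\<^sub>R coord_vec M c p e + b *\<^sub>R coord_vec M c p e'"
proof
  fix f
  have "linear (frechet_derivative (f \<circ> chart_inv c) (at (snd c p)))" if "smooth_near M p f"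
    using smooth_near_differentiable[OF that c] by (rule linear_frechet_derivative)
  then show "coord_vec M c p (a *\<^sub>R e + b *\<^sub>R e') f =
      (a *\<^sub>R coord_vec M c p e + b *\<^sub>R coord_vec M c p e') f"
    by (simp add: coord_vec_def linear_add linear_scale)
qed

lemma tangent_subspace:
  assumes "p \<in> points M"
  shows "subspace (T p)"
proof -
  let ?c = "chart_at M p"
  note c = chart_at[OF assms]
  have lin: "a *\<^sub>R v + b *\<^sub>R w \<in> T p" if "v \<in> T p" "w \<in> T p" for a b v w
    using that by (elim tangent_spaceE[OF _ c]) (simp add: coord_vec_linear[OF c, symmetric] tangent_spaceI[OF c])
  show ?thesis
    unfolding subspace_def
  proof (intro conjI ballI allI)
    show "0 \<in> T p" using lin[of "coord_vec M ?c p 0" "coord_vec M ?c p 0" 0 0] tangent_spaceI[OF c] by simp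
    show "x + y \<in> T p" if "x \<in> T p" "y \<in> T p" for x y using lin[OF that, of 1 1] by simp
    show "a *\<^sub>R x \<in> T p" if "x \<in> T p" for a x using lin[OF that that, of a 0] by simp
  qed
qed

text \<open>A derivative in a chart depends only on the germ of the function; if that germ is not
  smooth, both sides are the default value 0.\<close>

lemma tangent_cong:
  assumes p: "p \<in> points M" and v: "v \<in> T p"
    and V: "openin (mtop M) V" "p \<in> V" "\<And>q. q \<in> V \<Longrightarrow> f q = g q"
  shows "v f = v g"
proof -
  note c = chart_at[OF p]
  obtain e where e: "v = coord_vec M (chart_at M p) p e" by (rule tangent_spaceE[OF v c])
  show ?thesis
  proof (cases "smooth_near M p f")
    case True
    have "frechet_derivative (f \<circ> chart_inv (chart_at M p)) (at (snd (chart_at M p) p)) =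
        frechet_derivative (g \<circ> chart_inv (chart_at M p)) (at (snd (chart_at M p) p))"
      by (rule frechet_derivative_transform_within_open[OF smooth_near_differentiable[OF True c]
            chart_image_open[OF c(1) V(1)]])
        (use V c in \<open>auto simp: chart_inv_chart\<close>)
    with True smooth_near_cong[OF V] show ?thesis by (simp add: e coord_vec_def)
  next
    case False
    with smooth_near_cong[OF V] show ?thesis by (simp add: e coord_vec_def)
  qed
qed

text \<open>All four rules reduce to \<open>v_eq\<close>: on smooth functions \<open>v\<close> is
  the Frechet derivative in the chart at \<open>p\<close>, evaluated at a fixed vector
  \<open>e\<close>.\<close>

lemma
  assumes v: "v \<in> T p" and f: "smooth_fun M V f" and p: "p \<in> V"
  shows tangent_add: "smooth_fun M V g \<Longrightarrow> v (\<lambda>q. f q + g q) = v f + v g"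
    and tangent_mult: "smooth_fun M V g \<Longrightarrow> v (\<lambda>q. f q * g q) = v f * g p + f p * v g"
    and tangent_exp: "v (\<lambda>q. exp (f q)) = exp (f p) * v f"
    and tangent_const: "v (\<lambda>q. r) = 0"
proof -
  have V: "openin (mtop M) V" and "p \<in> points M"
    using smooth_fun_openin[OF f] openin_subset p by auto
  let ?c = "chart_at M p"
  let ?D = "\<lambda>f. frechet_derivative (f \<circ> chart_inv ?c) (at (snd ?c p))"
  note c = chart_at[OF \<open>p \<in> points M\<close>]
  obtain e where e: "v = coord_vec M ?c p e" by (rule tangent_spaceE[OF v c])
  have hd: "(h \<circ> chart_inv ?c has_derivative ?D h) (at (snd ?c p))" if "smooth_fun M V h" for h
    using smooth_fun_differentiable[OF that c p] frechet_derivative_works by blast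
  have v_eq: "v h = h' e"
    if "smooth_fun M V h" "(h \<circ> chart_inv ?c has_derivative h') (at (snd ?c p))" for h h'
    using that frechet_derivative_at[OF that(2)] p by (auto simp: e coord_vec_def dest: smooth_nearI)
  have inv: "chart_inv ?c (snd ?c p) = p" by (rule chart_inv_chart[OF c])
  show "v (\<lambda>q. f q + g q) = v f + v g" if g: "smooth_fun M V g"
    using v_eq[OF smooth_fun_add[OF f g], of "\<lambda>e. ?D f e + ?D g e"]
      has_derivative_add[OF hd[OF f] hd[OF g]] v_eq[OF f hd[OF f]] v_eq[OF g hd[OF g]]
    by (simp add: o_def)
  show "v (\<lambda>q. f q * g q) = v f * g p + f p * v g" if g: "smooth_fun M V g"
    using v_eq[OF smooth_fun_mult[OF f g], of "\<lambda>e. f p * ?D g e + ?D f e * g p"]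
      has_derivative_mult[OF hd[OF f] hd[OF g]] v_eq[OF f hd[OF f]] v_eq[OF g hd[OF g]] inv
    by (simp add: o_def)
  have "((\<lambda>x. exp ((f \<circ> chart_inv ?c) x)) has_derivative (\<lambda>e. exp (f p) * ?D f e)) (at (snd ?c p))"
    using has_derivative_exp[OF hd[OF f]] by (simp add: inv mult.commute)
  then show "v (\<lambda>q. exp (f q)) = exp (f p) * v f"
    using v_eq[OF smooth_fun_exp[OF f], of "\<lambda>e. exp (f p) * ?D f e"] v_eq[OF f hd[OF f]]
    by (simp add: o_def)
  show "v (\<lambda>q. r) = 0"
    using v_eq[OF smooth_fun_const[OF V, of r], of "\<lambda>e. 0"] by (simp add: o_def)
qed

lemma tangent_cmult:
  assumes v: "v \<in> T p" and f: "smooth_fun M V f" and p: "p \<in> V"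
  shows "v (\<lambda>q. r * f q) = r * v f"
  using tangent_mult[OF v smooth_fun_const[OF smooth_fun_openin[OF f]] p f, of r] tangent_const[OF v f p]
  by simp

lemma tangent_minus:
  assumes v: "v \<in> T p" and f: "smooth_fun M V f" and p: "p \<in> V"
  shows "v (\<lambda>q. - f q) = - v f"
  using tangent_cmult[OF assms, of "- 1"] by simp

lemma tangent_diff:
  assumes v: "v \<in> T p" and f: "smooth_fun M V f" and p: "p \<in> V" and g: "smooth_fun M V g"
  shows "v (\<lambda>q. f q - g q) = v f - v g"
  using tangent_add[OF v f p smooth_fun_minus[OF g]] tangent_minus[OF v g p] by simp

section \<open>Vector fields\<close>

lemma vector_field_openin: "vector_field M V X \<Longrightarrow> openin (mtop M) V"
  by (simp add: vector_field_def)

lemma vector_field_tangent: "vector_field M V X \<Longrightarrow> p \<in> V \<Longrightarrow> X p \<in> T p"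
  by (simp add: vector_field_def)

lemma vector_field_smooth: "vector_field M V X \<Longrightarrow> W \<subseteq> V \<Longrightarrow> smooth_fun M W f \<Longrightarrow> smooth_fun M W (\<lambda>p. X p f)"
  by (simp add: vector_field_def)

lemma vector_field_points: "vector_field M V X \<Longrightarrow> p \<in> V \<Longrightarrow> p \<in> points M"
  using openin_subset vector_field_openin by blast

lemma vector_field_subset:
  "vector_field M V X \<Longrightarrow> openin (mtop M) W \<Longrightarrow> W \<subseteq> V \<Longrightarrow> vector_field M W X"
  unfolding vector_field_def by (meson order_trans subsetD)

lemma vector_field_cong:
  assumes "vector_field M V X" "\<And>p. p \<in> V \<Longrightarrow> X p = Y p"
  shows "vector_field M V Y"
  unfolding vector_field_def
proof (intro conjI allI impI ballI)
  show "smooth_fun M W (\<lambda>p. Y p f)" if "W \<subseteq> V \<and> smooth_fun M W f" for W f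
    by (rule smooth_fun_cong[OF vector_field_smooth[OF assms(1)]]) (use that assms(2) in auto)
qed (use assms vector_field_openin vector_field_tangent in force)+

lemma vector_field_local:
  assumes "\<And>p. p \<in> V \<Longrightarrow> \<exists>W. p \<in> W \<and> W \<subseteq> V \<and> vector_field M W X"
  shows "vector_field M V X"
  unfolding vector_field_def
proof (intro conjI allI impI ballI)
  show V: "openin (mtop M) V"
    using assms vector_field_openin by (subst openin_subopen) meson
  show "X p \<in> T p" if "p \<in> V" for p using assms[OF that] vector_field_tangent by blast
  show "smooth_fun M W (\<lambda>p. X p f)" if W: "W \<subseteq> V \<and> smooth_fun M W f" for W f
  proof (rule smooth_fun_local)
    fix p assume p: "p \<in> W"
    with W assms[of p] obtain U where U: "p \<in> U" "U \<subseteq> V" "vector_field M U X" by blast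
    have "openin (mtop M) (U \<inter> W)"
      using U W vector_field_openin smooth_fun_openin by blast
    then have "smooth_fun M (U \<inter> W) (\<lambda>p. X p f)"
      using U W by (auto intro!: vector_field_smooth[OF U(3)] intro: smooth_fun_subset)
    then show "\<exists>U. p \<in> U \<and> U \<subseteq> W \<and> smooth_fun M U (\<lambda>p. X p f)" using p U by blast
  qed
qed

lemma vector_field_add:
  assumes "vector_field M V X" "vector_field M V Y"
  shows "vector_field M V (\<lambda>q. X q + Y q)"
  using assms unfolding vector_field_def
  by (auto intro!: smooth_fun_add subspace_add[OF tangent_subspace] dest: openin_subset)

lemma vector_field_scaleR:
  assumes "smooth_fun M V f" "vector_field M V X"
  shows "vector_field M V (\<lambda>q. f q *\<^sub>R X q)"
  using assms unfolding vector_field_def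
  by (auto intro!: smooth_fun_mult subspace_scale[OF tangent_subspace]
      intro: smooth_fun_subset smooth_fun_openin dest: openin_subset)

lemma vector_field_cscaleR:
  assumes "vector_field M V X"
  shows "vector_field M V (\<lambda>q. r *\<^sub>R X q)"
  using vector_field_scaleR[OF smooth_fun_const assms] assms vector_field_openin by blast

lemma vector_field_minus:
  assumes "vector_field M V X"
  shows "vector_field M V (\<lambda>q. - X q)"
  using vector_field_cscaleR[OF assms, of "- 1"] by simp

lemma vector_field_diff:
  assumes "vector_field M V X" "vector_field M V Y"
  shows "vector_field M V (\<lambda>q. X q - Y q)"
  using vector_field_add[OF assms(1) vector_field_minus[OF assms(2)]] by simp

section \<open>Coordinate vector fields, their brackets and the exterior derivative of
  1-forms\<close>

text \<open>Read in another chart \<open>d\<close>, the derivative of \<open>f\<close> along the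
  field is the derivative computed in \<open>c\<close>, composed with the transition map; both
  factors are smooth.\<close>

lemma coord_vec_field:
  assumes c: "c \<in> atlas M"
  shows "vector_field M (fst c) (\<lambda>q. coord_vec M c q e)"
  unfolding vector_field_def
proof (intro conjI ballI allI impI)
  show "openin (mtop M) (fst c)" by (rule chart_openin[OF c])
  show "coord_vec M c p e \<in> T p" if "p \<in> fst c" for p using tangent_spaceI[OF c that] .
  fix W f assume W: "W \<subseteq> fst c \<and> smooth_fun M W f"
  then have oW: "openin (mtop M) W" by (auto dest: smooth_fun_openin)
  show "smooth_fun M W (\<lambda>q. coord_vec M c q e f)"
  proof (rule smooth_funI[OF oW])
    fix d n assume d: "d \<in> atlas M" and S: "open (snd d ` (fst d \<inter> W))"
    let ?h = "\<lambda>x. frechet_derivative (f \<circ> chart_inv c) (at x) e"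
    have "smooth_on (snd c ` (fst c \<inter> W)) ?h"
      using W c by (auto intro: smooth_on_frechet_derivative simp: smooth_fun_def)
    moreover have "smooth_on (snd d ` (fst d \<inter> W)) (snd c \<circ> chart_inv d)"
      using W by (intro smooth_on_subset[OF transition_smooth[OF d c]]) auto
    ultimately have "Ck_on n (snd d ` (fst d \<inter> W)) (?h \<circ> (snd c \<circ> chart_inv d))"
      using W unfolding smooth_on_def
      by (intro Ck_on_compose[OF S, where T = "snd c ` (fst c \<inter> W)"]) (auto simp: chart_inv_chart[OF d])
    then show "Ck_on n (snd d ` (fst d \<inter> W)) (\<lambda>x. coord_vec M c (chart_inv d x) e f)"
      by (rule Ck_on_cong[OF S]) (use W in \<open>auto simp: chart_inv_chart[OF d] coord_vec_def dest: smooth_nearI\<close>)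
  qed
qed

text \<open>The coordinate function \<open>snd c q \<bullet> e\<close> detects the vector: its
  derivative along \<open>e\<close> is \<open>e \<bullet> e\<close>.\<close>

lemma coord_vec_nonzero:
  assumes c: "c \<in> atlas M" "p \<in> fst c" and e: "e \<noteq> 0"
  shows "coord_vec M c p e \<noteq> 0"
proof
  assume zero: "coord_vec M c p e = 0"
  let ?f = "\<lambda>q. snd c q \<bullet> e"
  have f: "smooth_fun M (fst c) ?f"
  proof (rule smooth_funI)
    fix d n assume d: "d \<in> atlas M" "open (snd d ` (fst d \<inter> fst c))"
    show "Ck_on n (snd d ` (fst d \<inter> fst c)) (\<lambda>x. snd c (chart_inv d x) \<bullet> e)"
      using transition_smooth[OF d(1) c(1)] unfolding smooth_on_def
      by (intro Ck_on_linear_compose[OF d(2) _ bounded_linear_inner_left]) (simp add: o_def)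
  qed (rule chart_openin[OF c(1)])
  have hd: "((\<lambda>x. x \<bullet> e) has_derivative (\<lambda>x. x \<bullet> e)) (at (snd c p))"
    by (rule bounded_linear_imp_has_derivative[OF bounded_linear_inner_left])
  have "(?f \<circ> chart_inv c has_derivative (\<lambda>x. x \<bullet> e)) (at (snd c p))"
    by (rule has_derivative_transform_within_open[OF hd, where s = "snd c ` (fst c \<inter> fst c)"])
      (use chart_image_open[OF c(1) chart_openin[OF c(1)]] c(2) in \<open>auto simp: chart_inv_chart[OF c(1)]\<close>)
  then have "coord_vec M c p e ?f = e \<bullet> e"
    using smooth_nearI[OF f c(2)] by (simp add: coord_vec_def frechet_derivative_at[symmetric])
  with zero e show False by simp
qed

text \<open>In the chart, the two terms of the bracket are the two mixed second derivatives of
  \<open>f\<close>.\<close>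

lemma lie_bracket_coord_vec:
  assumes c: "c \<in> atlas M" and p: "p \<in> fst c"
  shows "lie_bracket M (\<lambda>q. coord_vec M c q u) (\<lambda>q. coord_vec M c q w) p = 0"
proof
  fix f
  show "lie_bracket M (\<lambda>q. coord_vec M c q u) (\<lambda>q. coord_vec M c q w) p f = 0 f"
  proof (cases "smooth_near M p f")
    case True
    then obtain W0 where W0: "p \<in> W0" "smooth_fun M W0 f" unfolding smooth_near_def by blast
    define W where "W = W0 \<inter> fst c"
    have oW: "openin (mtop M) W"
      unfolding W_def using smooth_fun_openin[OF W0(2)] chart_openin[OF c] by blast
    have W: "p \<in> W" "W \<subseteq> fst c" "smooth_fun M W f"
      using W0 p smooth_fun_subset[OF W0(2) oW] by (auto simp: W_def)
    let ?S = "snd c ` (fst c \<inter> W)"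
    have S: "open ?S" "snd c p \<in> ?S" "smooth_on ?S (f \<circ> chart_inv c)"
      using chart_image_open[OF c oW] W c by (auto simp: smooth_fun_def)
    have second: "coord_vec M c p u (\<lambda>q. coord_vec M c q w f) =
      frechet_derivative (\<lambda>z. frechet_derivative (f \<circ> chart_inv c) (at z) w) (at (snd c p)) u" for u w
    proof -
      have sm: "smooth_fun M W (\<lambda>q. coord_vec M c q w f)"
        by (rule vector_field_smooth[OF coord_vec_field[OF c] W(2,3)])
      have "frechet_derivative ((\<lambda>q. coord_vec M c q w f) \<circ> chart_inv c) (at (snd c p)) =
        frechet_derivative (\<lambda>z. frechet_derivative (f \<circ> chart_inv c) (at z) w) (at (snd c p))"
        by (rule frechet_derivative_transform_within_open[OF smooth_fun_differentiable[OF sm c p W(1)] S(1,2)])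
          (use W in \<open>auto simp: chart_inv_chart[OF c] coord_vec_def dest: smooth_nearI\<close>)
      then show ?thesis using smooth_nearI[OF sm W(1)] by (simp add: coord_vec_def)
    qed
    show ?thesis
      using symmetric_frechet_derivative[OF S(1,3,2)] True by (simp add: lie_bracket_def second)
  qed (simp add: lie_bracket_def)
qed

text \<open>Replaces the choice hidden in \<open>coord_extension\<close> by a concrete coefficient
  vector, so that the facts about \<open>coord_vec\<close> apply.\<close>

lemma coord_extension_eq:
  assumes p: "p \<in> points M" and v: "v \<in> T p"
  obtains e where "coord_extension M p v = (\<lambda>q. coord_vec M (chart_at M p) q e)"
    "coord_vec M (chart_at M p) p e = v"
proof -
  obtain e where "v = coord_vec M (chart_at M p) p e" by (rule tangent_spaceE[OF v chart_at[OF p]])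
  then have "coord_vec M (chart_at M p) p (SOME e. coord_vec M (chart_at M p) p e = v) = v"
    by (metis (mono_tags, lifting) someI)
  then show thesis by (intro that) (auto simp: coord_extension_def)
qed

lemma
  assumes p: "p \<in> points M" and v: "v \<in> T p"
  shows coord_extension_field: "vector_field M (fst (chart_at M p)) (coord_extension M p v)"
    and coord_extension_self: "coord_extension M p v p = v"
  using coord_extension_eq[OF assms] coord_vec_field chart_at[OF p] by metis+

lemma lie_bracket_coord_extension:
  assumes p: "p \<in> points M" and v: "v \<in> T p" and w: "w \<in> T p"
  shows "lie_bracket M (coord_extension M p v) (coord_extension M p w) p = 0"
  using coord_extension_eq[OF p v] coord_extension_eq[OF p w] lie_bracket_coord_vec[OF chart_at[OF p]]
  by metis

lemma ext_deriv_1form: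
  "ext_deriv M \<omega> p [v, w] =
    v (\<lambda>q. \<omega> q [coord_extension M p w q]) - w (\<lambda>q. \<omega> q [coord_extension M p v q])"
  by (simp add: ext_deriv_def)

end

section \<open>Quaternionic Hermitian algebra at a point\<close>

lemma linear_on_subspaceD:
  assumes "linear_on_subspace S h"
  shows "v \<in> S \<Longrightarrow> w \<in> S \<Longrightarrow> h (v + w) = h v + h w"
    and "v \<in> S \<Longrightarrow> h (a *\<^sub>R v) = a *\<^sub>R h v"
    and "v \<in> S \<Longrightarrow> h (- v) = - h v"
    and "v \<in> S \<Longrightarrow> w \<in> S \<Longrightarrow> h (v - w) = h v - h w"
proof -
  have *: "h (a *\<^sub>R v + b *\<^sub>R w) = a *\<^sub>R h v + b *\<^sub>R h w" if "v \<in> S" "w \<in> S" for a b v w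
    using assms that unfolding linear_on_subspace_def by blast
  show "h (v + w) = h v + h w" if "v \<in> S" "w \<in> S" using *[OF that, of 1 1] by simp
  show "h (a *\<^sub>R v) = a *\<^sub>R h v" if "v \<in> S" using *[OF that that, of a 0] by simp
  show "h (- v) = - h v" if "v \<in> S" using *[OF that that, of "- 1" 0] by simp
  show "h (v - w) = h v - h w" if "v \<in> S" "w \<in> S" using *[OF that, of 1 "- 1"] by simp
qed

text \<open>Models one tangent space. Tangent spaces are subspaces of a space of operators rather
  than types, so the algebra is relative to a carrier \<open>S\<close>; the closure facts are simp
  rules that discharge the membership conditions.\<close>

locale quaternionic_hermitian =
  fixes S :: "'v::real_vector set" and g :: "'v \<Rightarrow> 'v \<Rightarrow> real" and I1 I2 I3 :: "'v \<Rightarrow> 'v"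
  assumes S: "subspace S"
    and g_linear: "\<And>v. v \<in> S \<Longrightarrow> linear_on_subspace S (g v)"
    and g_sym: "\<And>v w. v \<in> S \<Longrightarrow> w \<in> S \<Longrightarrow> g v w = g w v"
    and g_pos: "\<And>v. v \<in> S \<Longrightarrow> v \<noteq> 0 \<Longrightarrow> g v v > 0"
    and I_linear: "linear_on_subspace S I1" "linear_on_subspace S I2" "linear_on_subspace S I3"
    and I_closed [simp]: "\<And>v. v \<in> S \<Longrightarrow> I1 v \<in> S" "\<And>v. v \<in> S \<Longrightarrow> I2 v \<in> S" "\<And>v. v \<in> S \<Longrightarrow> I3 v \<in> S"
    and I_square [simp]: "\<And>v. v \<in> S \<Longrightarrow> I1 (I1 v) = - v" "\<And>v. v \<in> S \<Longrightarrow> I2 (I2 v) = - v"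
      "\<And>v. v \<in> S \<Longrightarrow> I3 (I3 v) = - v"
    and I12 [simp]: "\<And>v. v \<in> S \<Longrightarrow> I1 (I2 v) = I3 v" "\<And>v. v \<in> S \<Longrightarrow> I2 (I1 v) = - I3 v"
    and g_I: "\<And>v w. v \<in> S \<Longrightarrow> w \<in> S \<Longrightarrow> g (I1 v) (I1 w) = g v w"
      "\<And>v w. v \<in> S \<Longrightarrow> w \<in> S \<Longrightarrow> g (I2 v) (I2 w) = g v w"
      "\<And>v w. v \<in> S \<Longrightarrow> w \<in> S \<Longrightarrow> g (I3 v) (I3 w) = g v w"
begin

lemmas S_closed [simp] = subspace_add[OF S] subspace_diff[OF S] subspace_scale[OF S] subspace_neg[OF S]
  subspace_0[OF S]

lemmas I_simps [simp] = linear_on_subspaceD[OF I_linear(1)] linear_on_subspaceD[OF I_linear(2)]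
  linear_on_subspaceD[OF I_linear(3)]

lemmas g_right [simp] = linear_on_subspaceD[OF g_linear, simplified real_scaleR_def]

lemma g_left [simp]:
  assumes "v \<in> S" "w \<in> S" "u \<in> S"
  shows "g (v + w) u = g v u + g w u" "g (a *\<^sub>R v) u = a * g v u" "g (- v) u = - g v u"
    "g (v - w) u = g v u - g w u"
  using assms by (simp_all add: g_sym[of _ u])

lemma g_zero [simp]: "v \<in> S \<Longrightarrow> g v 0 = 0" "v \<in> S \<Longrightarrow> g 0 v = 0"
  using g_right(2)[of v 0 0] g_left(2)[of 0 0 v 0] by auto

lemma I_table [simp]:
  assumes "v \<in> S"
  shows "I2 (I3 v) = I1 v" "I3 (I2 v) = - I1 v" "I3 (I1 v) = I2 v" "I1 (I3 v) = - I2 v"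
proof -
  have 13: "I1 (I3 v) = - I2 v" if "v \<in> S" for v
    using that I12(1)[of v] I_square(1)[of "I2 v"] by simp
  then show "I1 (I3 v) = - I2 v" using assms .
  have 31: "I3 (I1 v) = I2 v" if "v \<in> S" for v
    using that I12(1)[of "I1 v"] 13[OF that] by simp
  then show "I3 (I1 v) = I2 v" using assms .
  have 32: "I3 (I2 v) = - I1 v" if "v \<in> S" for v
    using that I12(1)[of "I2 v"] by simp
  then show "I3 (I2 v) = - I1 v" using assms .
  show "I2 (I3 v) = I1 v"
    using assms I_square(2)[of "I1 v"] by simp
qed

text \<open>An isometry with square -1 is skew. As rewrite rules, these equations move every
  \<open>I_r\<close> into the left argument of \<open>g\<close>.\<close>

lemma g_I_right:
  assumes "v \<in> S" "w \<in> S"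
  shows "g v (I1 w) = - g (I1 v) w" "g v (I2 w) = - g (I2 v) w" "g v (I3 w) = - g (I3 v) w"
  using assms g_I(1)[of v "I1 w"] g_I(2)[of v "I2 w"] g_I(3)[of v "I3 w"] by simp_all

lemma g_I_swap:
  assumes "v \<in> S" "w \<in> S"
  shows "g (I1 v) w = - g (I1 w) v" "g (I2 v) w = - g (I2 w) v" "g (I3 v) w = - g (I3 w) v"
  using assms g_I_right g_sym[of _ v] by simp_all

lemma g_I_self [simp]:
  assumes "v \<in> S"
  shows "g (I1 v) v = 0" "g (I2 v) v = 0" "g (I3 v) v = 0"
  using g_I_swap[OF assms assms] by simp_all

text \<open>Testing with \<open>u = v - w\<close> gives \<open>g (v - w) (v - w) = 0\<close>,
  against positivity unless \<open>v = w\<close>.\<close>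

lemma g_eqI:
  assumes "v \<in> S" "w \<in> S" "\<And>u. u \<in> S \<Longrightarrow> g v u = g w u"
  shows "v = w"
  using assms g_pos[of "v - w"] by force

end

text \<open>In the following \<open>B\<close> is the dual of the Lee form \<open>\<theta>\<close>, so that \<open>I\<^sub>rB\<close> is the dual of \<open>\<theta>\<^sub>r\<close>,
  and \<open>gh\<close> is the metric \<open>ghat\<close> of the theorem.\<close>

locale quaternionic_hermitian_unit = quaternionic_hermitian S g I1 I2 I3
  for S :: "'v::real_vector set" and g :: "'v \<Rightarrow> 'v \<Rightarrow> real" and I1 I2 I3 :: "'v \<Rightarrow> 'v" +
  fixes B :: 'v
  assumes B [simp]: "B \<in> S" and g_B [simp]: "g B B = 1"
begin

abbreviation t where "t \<equiv> g B"
abbreviation t1 where "t1 \<equiv> g (I1 B)"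
abbreviation t2 where "t2 \<equiv> g (I2 B)"
abbreviation t3 where "t3 \<equiv> g (I3 B)"

definition gh where
  "gh v w = g v w - 1 / 2 * (t v * t w + t1 v * t1 w + t2 v * t2 w + t3 v * t3 w)"

text \<open>The difference of the HKT connection of \<open>gh\<close> and the Levi-Civita connection of \<open>g\<close>. It is found
  by writing the former as the hyperkaehler connection plus a tensor, which the requirement to
  preserve \<open>gh\<close> with torsion
  \<open>-\<Sum>\<^sub>r \<theta>\<^sub>r \<and> F\<^sub>r / 2 + \<theta>\<^sub>1 \<and> \<theta>\<^sub>2 \<and> \<theta>\<^sub>3\<close> determines.\<close>

definition A where
  "A v w = (1 / 2) *\<^sub>R (t1 w *\<^sub>R I1 v + t2 w *\<^sub>R I2 v + t3 w *\<^sub>R I3 v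
     + (t1 v * t1 w + t2 v * t2 w + t3 v * t3 w) *\<^sub>R B
     + (t2 v * t3 w - t3 v * t2 w - t1 v * t w - g (I1 v) w) *\<^sub>R I1 B
     + (t3 v * t1 w - t1 v * t3 w - t2 v * t w - g (I2 v) w) *\<^sub>R I2 B
     + (t1 v * t2 w - t2 v * t1 w - t3 v * t w - g (I3 v) w) *\<^sub>R I3 B)"

section \<open>Algebra of the modified metric\<close>

lemma gh_linear: "v \<in> S \<Longrightarrow> linear_on_subspace S (gh v)"
  unfolding linear_on_subspace_def gh_def by (simp add: algebra_simps)

lemmas gh_right [simp] = linear_on_subspaceD[OF gh_linear, simplified real_scaleR_def]

lemma gh_sym: "v \<in> S \<Longrightarrow> w \<in> S \<Longrightarrow> gh v w = gh w v"
  unfolding gh_def by (simp add: g_sym[of v w] mult.commute)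

lemma gh_left [simp]:
  assumes "v \<in> S" "w \<in> S" "u \<in> S"
  shows "gh (v + w) u = gh v u + gh w u" "gh (a *\<^sub>R v) u = a * gh v u" "gh (- v) u = - gh v u"
    "gh (v - w) u = gh v u - gh w u"
  using assms by (simp_all add: gh_sym[of _ u])

text \<open>Bessel's inequality: \<open>B\<close>, \<open>I1 B\<close>, \<open>I2 B\<close>,
  \<open>I3 B\<close> are orthonormal and \<open>r\<close> is the part of \<open>v\<close>
  orthogonal to them, so the four squares sum to at most \<open>g v v\<close>. Subtracting half of
  that sum leaves at least \<open>g v v / 2\<close>.\<close>

lemma gh_pos:
  assumes v: "v \<in> S" "v \<noteq> 0"
  shows "gh v v > 0"
proof -
  define r where "r = v - t v *\<^sub>R B - t1 v *\<^sub>R I1 B - t2 v *\<^sub>R I2 B - t3 v *\<^sub>R I3 B"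
  have "r \<in> S" using v by (simp add: r_def)
  then have "g r r \<ge> 0" by (cases "r = 0") (auto dest: g_pos)
  moreover have "g r r = g v v - (t v * t v + t1 v * t1 v + t2 v * t2 v + t3 v * t3 v)"
    using v unfolding r_def
    by (simp add: g_sym[of v B] g_I_swap[of v B] g_sym[of v "I1 B"] g_sym[of v "I2 B"] g_sym[of v "I3 B"] g_I_right
        g_sym[of B "I1 B"] g_sym[of B "I2 B"] g_sym[of B "I3 B"] algebra_simps)
  ultimately show ?thesis using g_pos[OF v] unfolding gh_def by (simp add: field_simps)
qed

text \<open>Each \<open>I_r\<close> permutes the four covectors \<open>t\<close>, \<open>t1\<close>,
  \<open>t2\<close>, \<open>t3\<close> up to sign, so the sum of their products is
  invariant.\<close>

lemma gh_I:
  assumes "v \<in> S" "w \<in> S"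
  shows "gh (I1 v) (I1 w) = gh v w" "gh (I2 v) (I2 w) = gh v w" "gh (I3 v) (I3 w) = gh v w"
  using assms unfolding gh_def by (simp_all add: g_I_right)

lemma gh_fundamental:
  assumes "v \<in> S" "w \<in> S"
  shows
    "gh (I1 v) w = g (I1 v) w - (t v * t1 w - t1 v * t w + t2 v * t3 w - t3 v * t2 w) / 2"
    "gh (I2 v) w = g (I2 v) w - (t v * t2 w - t2 v * t w + t3 v * t1 w - t1 v * t3 w) / 2"
    "gh (I3 v) w = g (I3 v) w - (t v * t3 w - t3 v * t w + t1 v * t2 w - t2 v * t1 w) / 2"
  using assms unfolding gh_def by (simp_all add: g_I_right field_simps)

text \<open>Pairing with the quaternionic line of \<open>B\<close> is halved by the correction term;
  hence the factors 1/4 in \<open>gh_A\<close>.\<close>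

lemma gh_B:
  assumes "v \<in> S"
  shows "gh B v = t v / 2" "gh (I1 B) v = t1 v / 2" "gh (I2 B) v = t2 v / 2" "gh (I3 B) v = t3 v / 2"
  using assms unfolding gh_def by (simp_all add: g_I_right)

section \<open>Algebra of the difference tensor and of the torsion\<close>

lemma A_closed [simp]: "v \<in> S \<Longrightarrow> w \<in> S \<Longrightarrow> A v w \<in> S"
  by (simp add: A_def)

lemma A_linear_right: "v \<in> S \<Longrightarrow> linear_on_subspace S (A v)"
  unfolding linear_on_subspace_def A_def by (simp add: algebra_simps)

lemma A_linear_left: "w \<in> S \<Longrightarrow> linear_on_subspace S (\<lambda>v. A v w)"
  unfolding linear_on_subspace_def A_def by (simp add: algebra_simps)

text \<open>The right-hand sides are the negatives of the terms by which \<open>nabla\<close> fails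
  to commute with \<open>I_r\<close> in \<open>nabla_I\<close>; adding \<open>A\<close> therefore
  makes each \<open>I_r\<close> parallel.\<close>

lemma A_I:
  assumes "v \<in> S" "w \<in> S"
  shows "A v (I1 w) - I1 (A v w) =
      - (1 / 2) *\<^sub>R (t (I1 w) *\<^sub>R v - t w *\<^sub>R I1 v - g v (I1 w) *\<^sub>R B + g v w *\<^sub>R I1 B)"
    and "A v (I2 w) - I2 (A v w) =
      - (1 / 2) *\<^sub>R (t (I2 w) *\<^sub>R v - t w *\<^sub>R I2 v - g v (I2 w) *\<^sub>R B + g v w *\<^sub>R I2 B)"
    and "A v (I3 w) - I3 (A v w) =
      - (1 / 2) *\<^sub>R (t (I3 w) *\<^sub>R v - t w *\<^sub>R I3 v - g v (I3 w) *\<^sub>R B + g v w *\<^sub>R I3 B)"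
  using assms unfolding A_def by (simp_all add: g_I_right algebra_simps)

lemma gh_A:
  assumes "v \<in> S" "w \<in> S" "u \<in> S"
  shows "gh (A v w) u = (t1 w * gh (I1 v) u + t2 w * gh (I2 v) u + t3 w * gh (I3 v) u) / 2
     + (t1 v * t1 w + t2 v * t2 w + t3 v * t3 w) * t u / 4
     + (t2 v * t3 w - t3 v * t2 w - t1 v * t w - g (I1 v) w) * t1 u / 4
     + (t3 v * t1 w - t1 v * t3 w - t2 v * t w - g (I2 v) w) * t2 u / 4
     + (t1 v * t2 w - t2 v * t1 w - t3 v * t w - g (I3 v) w) * t3 u / 4"
  using assms unfolding A_def by (simp add: gh_B field_simps)

text \<open>The covariant derivatives of \<open>\<theta>\<^sub>r\<close> and \<open>gh\<close>, for the Levi-Civita connection of \<open>g\<close>.\<close>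

definition dt where
  "dt I v w = (t v * g (I B) w - g (I B) v * t w - g (I v) w) / 2"

definition dgh where
  "dgh v w u = - 1 / 2 * (dt I1 v w * t1 u + t1 w * dt I1 v u + dt I2 v w * t2 u + t2 w * dt I2 v u
     + dt I3 v w * t3 u + t3 w * dt I3 v u)"

text \<open>\<open>dgh\<close> is what differentiating \<open>gh\<close> by \<open>nabla\<close>
  leaves over; the two terms that \<open>A\<close> adds to the product rule account for exactly
  this.\<close>

lemma gh_A_metric:
  assumes "v \<in> S" "w \<in> S" "u \<in> S"
  shows "gh (A v w) u + gh w (A v u) = dgh v w u"
  using assms by (simp add: gh_sym[of w] gh_A gh_fundamental dgh_def dt_def field_simps)

text \<open>The torsion of \<open>nabla + A\<close> lowered by \<open>gh\<close>: since
  \<open>nabla\<close> is torsion free, only the skew part of \<open>A\<close> remains.\<close>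

definition c where
  "c v w u = gh (A v w - A w v) u"

text \<open>The first equation is built into the definition. The other two carry the HKT condition,
  that the torsion is skew in its last slot too; they follow by expanding with \<open>gh_A\<close>
  and \<open>gh_fundamental\<close>.\<close>

lemma c_alternating:
  assumes "v \<in> S" "w \<in> S"
  shows "c v v w = 0" "c v w v = 0" "c v w w = 0"
  using assms
  by (simp_all add: c_def gh_def[of 0] gh_A gh_fundamental g_I_swap[of w v] field_simps)

lemma c_linear:
  assumes "v \<in> S" "w \<in> S"
  shows "linear_on_subspace S (\<lambda>u. c u v w)" "linear_on_subspace S (\<lambda>u. c v u w)"
    "linear_on_subspace S (\<lambda>u. c v w u)"
  using assms A_linear_left A_linear_right unfolding linear_on_subspace_def c_def
  by (simp_all add: algebra_simps)

end

section \<open>Connections and conformal change\<close>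

lemma linear_on_subspace_cong:
  assumes "subspace S" "\<And>v. v \<in> S \<Longrightarrow> h v = h' v"
  shows "linear_on_subspace S h \<longleftrightarrow> linear_on_subspace S h'"
  using assms unfolding linear_on_subspace_def by (auto simp: subspace_add subspace_scale)

lemma
  assumes "linear_connection M U D"
  shows linear_connection_field: "V \<subseteq> U \<Longrightarrow> vector_field M V X \<Longrightarrow> vector_field M V Y \<Longrightarrow>
      vector_field M V (\<lambda>p. D p (X p) Y)"
    and linear_connection_linear: "V \<subseteq> U \<Longrightarrow> vector_field M V Y \<Longrightarrow> p \<in> V \<Longrightarrow>
      linear_on_subspace (tangent_space M p) (\<lambda>v. D p v Y)"
    and linear_connection_tangent: "V \<subseteq> U \<Longrightarrow> vector_field M V Y \<Longrightarrow> p \<in> V \<Longrightarrow>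
      v \<in> tangent_space M p \<Longrightarrow> D p v Y \<in> tangent_space M p"
    and linear_connection_add: "V \<subseteq> U \<Longrightarrow> vector_field M V Y \<Longrightarrow> vector_field M V Z \<Longrightarrow> p \<in> V \<Longrightarrow>
      v \<in> tangent_space M p \<Longrightarrow> D p v (Y + Z) = D p v Y + D p v Z"
    and linear_connection_leibniz: "V \<subseteq> U \<Longrightarrow> smooth_fun M V f \<Longrightarrow> vector_field M V Y \<Longrightarrow> p \<in> V \<Longrightarrow>
      v \<in> tangent_space M p \<Longrightarrow> D p v (\<lambda>q. f q *\<^sub>R Y q) = v f *\<^sub>R Y p + f p *\<^sub>R D p v Y"
    and linear_connection_cong: "V \<subseteq> U \<Longrightarrow> vector_field M V Y \<Longrightarrow> vector_field M V Z \<Longrightarrow>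
      (\<forall>q\<in>V. Y q = Z q) \<Longrightarrow> p \<in> V \<Longrightarrow> v \<in> tangent_space M p \<Longrightarrow> D p v Y = D p v Z"
proof -
  note D = assms[unfolded linear_connection_def]
  note D1 = D[THEN conjunct1, rule_format]
    and D2 = D[THEN conjunct2, THEN conjunct1, rule_format]
    and D3 = D[THEN conjunct2, THEN conjunct2, THEN conjunct1, rule_format]
    and D4 = D[THEN conjunct2, THEN conjunct2, THEN conjunct2, THEN conjunct1, rule_format]
    and D5 = D[THEN conjunct2, THEN conjunct2, THEN conjunct2, THEN conjunct2, rule_format]
  show "V \<subseteq> U \<Longrightarrow> vector_field M V X \<Longrightarrow> vector_field M V Y \<Longrightarrow> vector_field M V (\<lambda>p. D p (X p) Y)"
    by (rule D1) simp
  show "V \<subseteq> U \<Longrightarrow> vector_field M V Y \<Longrightarrow> p \<in> V \<Longrightarrow>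
      linear_on_subspace (tangent_space M p) (\<lambda>v. D p v Y)"
    by (rule D2[THEN conjunct1]) auto
  show "V \<subseteq> U \<Longrightarrow> vector_field M V Y \<Longrightarrow> p \<in> V \<Longrightarrow> v \<in> tangent_space M p \<Longrightarrow>
      D p v Y \<in> tangent_space M p"
    by (rule D2[THEN conjunct2, THEN bspec]) auto
  show "V \<subseteq> U \<Longrightarrow> vector_field M V Y \<Longrightarrow> vector_field M V Z \<Longrightarrow> p \<in> V \<Longrightarrow>
      v \<in> tangent_space M p \<Longrightarrow> D p v (Y + Z) = D p v Y + D p v Z"
    by (rule D3[of V]) auto
  show "V \<subseteq> U \<Longrightarrow> smooth_fun M V f \<Longrightarrow> vector_field M V Y \<Longrightarrow> p \<in> V \<Longrightarrow>
      v \<in> tangent_space M p \<Longrightarrow> D p v (\<lambda>q. f q *\<^sub>R Y q) = v f *\<^sub>R Y p + f p *\<^sub>R D p v Y"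
    by (rule D4[of V]) auto
  show "V \<subseteq> U \<Longrightarrow> vector_field M V Y \<Longrightarrow> vector_field M V Z \<Longrightarrow>
      (\<forall>q\<in>V. Y q = Z q) \<Longrightarrow> p \<in> V \<Longrightarrow> v \<in> tangent_space M p \<Longrightarrow> D p v Y = D p v Z"
    by (rule D5[of V]) auto
qed

lemma riemannian_metric_smooth:
  "riemannian_metric M U g \<Longrightarrow> V \<subseteq> U \<Longrightarrow> vector_field M V X \<Longrightarrow> vector_field M V Y \<Longrightarrow>
    smooth_fun M V (\<lambda>p. g p (X p) (Y p))"
  using conjunct2[OF iffD1[OF riemannian_metric_def], rule_format, of M U g V X Y] by simp

lemma endo_field_vector_field:
  "endo_field M U I \<Longrightarrow> V \<subseteq> U \<Longrightarrow> vector_field M V X \<Longrightarrow> vector_field M V (\<lambda>p. I p (X p))"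
  unfolding endo_field_def by blast

lemma
  assumes "endo_field M U I" "p \<in> U"
  shows endo_field_linear: "linear_on_subspace (tangent_space M p) (I p)"
    and endo_field_closed: "v \<in> tangent_space M p \<Longrightarrow> I p v \<in> tangent_space M p"
  using bspec[OF conjunct1[OF iffD1[OF endo_field_def assms(1)]] assms(2)] by blast+

lemma
  assumes "riemannian_metric M U g" "p \<in> U" "v \<in> tangent_space M p"
  shows riemannian_metric_linear: "linear_on_subspace (tangent_space M p) (g p v)"
    and riemannian_metric_sym: "w \<in> tangent_space M p \<Longrightarrow> g p v w = g p w v"
    and riemannian_metric_pos: "v \<noteq> 0 \<Longrightarrow> g p v v > 0"
  using bspec[OF bspec[OF conjunct1[OF iffD1[OF riemannian_metric_def assms(1)]] assms(2)] assms(3)]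
  by blast+

lemma complex_structure_square:
  "complex_structure M U I \<Longrightarrow> p \<in> U \<Longrightarrow> v \<in> tangent_space M p \<Longrightarrow> I p (I p v) = - v"
  by (simp add: complex_structure_def)

lemma quaternionic_hermitian_tangent_space:
  assumes "smooth_manifold M" "hyperhermitian M U g I1 I2 I3" "p \<in> U" "p \<in> points M"
  shows "quaternionic_hermitian (tangent_space M p) (g p) (I1 p) (I2 p) (I3 p)"
proof -
  interpret smooth_mfd M by unfold_locales (rule assms(1))
  have hc: "hypercomplex M U I1 I2 I3" and rm: "riemannian_metric M U g"
    and comp: "\<forall>I\<in>{I1, I2, I3}. \<forall>p\<in>U. \<forall>v\<in>T p. \<forall>w\<in>T p. g p (I p v) (I p w) = g p v w"
    using assms(2) unfolding hyperhermitian_def by blast+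
  have cs: "complex_structure M U I1" "complex_structure M U I2" "complex_structure M U I3"
    and prod: "\<And>v. v \<in> T p \<Longrightarrow> I1 p (I2 p v) = I3 p v" "\<And>v. v \<in> T p \<Longrightarrow> I2 p (I1 p v) = - I3 p v"
    using hc assms(3) unfolding hypercomplex_def by blast+
  have ef: "endo_field M U I1" "endo_field M U I2" "endo_field M U I3"
    using cs unfolding complex_structure_def by blast+
  show ?thesis
    by (rule quaternionic_hermitian.intro)
      (use comp assms(3) in \<open>blast intro: tangent_subspace[OF assms(4)] riemannian_metric_linear[OF rm assms(3)]
        riemannian_metric_sym[OF rm assms(3)] riemannian_metric_pos[OF rm assms(3)]
        endo_field_linear[OF ef(1) assms(3)] endo_field_linear[OF ef(2) assms(3)] endo_field_linear[OF ef(3) assms(3)]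
        endo_field_closed[OF ef(1) assms(3)] endo_field_closed[OF ef(2) assms(3)] endo_field_closed[OF ef(3) assms(3)]
        complex_structure_square[OF cs(1) assms(3)] complex_structure_square[OF cs(2) assms(3)]
        complex_structure_square[OF cs(3) assms(3)] prod\<close>)+
qed

lemma levi_civita_torsion:
  assumes "levi_civita M U g D" "V \<subseteq> U" "vector_field M V X" "vector_field M V Y" "p \<in> V"
  shows "D p (X p) Y - D p (Y p) X = lie_bracket M X Y p"
proof -
  have "torsion M D X Y p = 0" using assms unfolding levi_civita_def by blast
  then show ?thesis by (simp add: torsion_def)
qed

lemma levi_civita_metric:
  assumes "levi_civita M U g D" "V \<subseteq> U" "vector_field M V X" "vector_field M V Y" "p \<in> V"
    "v \<in> tangent_space M p"
  shows "v (\<lambda>q. g q (X q) (Y q)) = g p (D p v X) (Y p) + g p (X p) (D p v Y)"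
  using assms unfolding levi_civita_def parallel_metric_def by blast

lemma levi_civita_linear_connection: "levi_civita M U g D \<Longrightarrow> linear_connection M U D"
  by (simp add: levi_civita_def)

context smooth_mfd
begin

text \<open>The difference of the two connections is symmetric and, up to the derivative of \<open>f\<close>,
  skew for the metric, so it is determined as in the Koszul formula.\<close>

lemma conformal_change:
  assumes lc: "levi_civita M (points M) g D" and lc': "levi_civita M U g' D'"
    and q: "\<And>p. p \<in> points M \<Longrightarrow> quaternionic_hermitian (T p) (g p) (I1 p) (I2 p) (I3 p)"
    and g': "riemannian_metric M U g'" and f: "smooth_fun M U f"
    and conf: "\<And>p v w. p \<in> U \<Longrightarrow> v \<in> T p \<Longrightarrow> w \<in> T p \<Longrightarrow> g p v w = exp (f p) * g' p v w"
    and V: "V \<subseteq> U" "vector_field M V Y" and p: "p \<in> V" and v: "v \<in> T p" and w: "w \<in> T p"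
  shows "2 * g p (D' p v Y - D p v Y) w = - v f * g p (Y p) w - Y p f * g p v w + w f * g p v (Y p)"
proof -
  have pM: "p \<in> points M" using V p vector_field_points by blast
  let ?W = "V \<inter> fst (chart_at M p)"
  define X where "X = coord_extension M p v"
  define Z where "Z = coord_extension M p w"
  note c = chart_at[OF pM]
  have W: "openin (mtop M) ?W" "p \<in> ?W" "?W \<subseteq> U"
    using vector_field_openin[OF V(2)] chart_openin[OF c(1)] V p c by auto
  have WM: "?W \<subseteq> points M" using W openin_subset by blast
  have pU: "p \<in> U" using V p by blast
  have fields: "vector_field M ?W X" "vector_field M ?W Y" "vector_field M ?W Z"
    using vector_field_subset[OF V(2) W(1)] vector_field_subset[OF coord_extension_field[OF pM] W(1)] v w
    by (auto simp: X_def Z_def)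
  have at_p: "X p = v" "Z p = w" using coord_extension_self[OF pM] v w by (auto simp: X_def Z_def)
  interpret h: quaternionic_hermitian "T p" "g p" "I1 p" "I2 p" "I3 p" by (rule q[OF pM])
  \<comment> \<open>The difference of the two connections, lowered by \<open>g\<close>. The vectors
    \<open>v\<close> and \<open>w\<close> have been extended to \<open>X\<close> and
    \<open>Z\<close> because torsion and metricity speak about fields.\<close>
  define s where "s X Y Z = g p (D' p (X p) Y - D p (X p) Y) (Z p)" for X Y Z :: "'a vfield"
  have tan: "D' p (X p) Y \<in> T p" "D p (X p) Y \<in> T p" "X p \<in> T p"
    if "vector_field M ?W X" "vector_field M ?W Y" for X Y
    using linear_connection_tangent[OF levi_civita_linear_connection[OF lc] WM that(2) W(2)]
      linear_connection_tangent[OF levi_civita_linear_connection[OF lc'] W(3) that(2) W(2)]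
      vector_field_tangent[OF that(1) W(2)] by auto
  have sym: "s X Y Z = s Y X Z" if "vector_field M ?W X" "vector_field M ?W Y" for X Y Z
  proof -
    have "D' p (X p) Y - D' p (Y p) X = D p (X p) Y - D p (Y p) X"
      using levi_civita_torsion[OF lc WM that W(2)] levi_civita_torsion[OF lc' W(3) that W(2)] by simp
    then have "D' p (X p) Y - D p (X p) Y = D' p (Y p) X - D p (Y p) X"
      by (simp add: algebra_simps)
    then show ?thesis by (simp add: s_def)
  qed
  \<comment> \<open>Differentiate \<open>g = exp f * g'\<close>: each metric is parallel for its own
    connection, so the derivative of the conformal factor is all that survives.\<close>
  have skew: "s X Y Z + s X Z Y = - X p f * g p (Y p) (Z p)"
    if X: "vector_field M ?W X" and Y: "vector_field M ?W Y" and Z: "vector_field M ?W Z" for X Y Z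
  proof -
    note v = vector_field_tangent[OF X W(2)]
    note fW = smooth_fun_subset[OF f W(1,3)]
    have "X p (\<lambda>q. g q (Y q) (Z q)) = X p (\<lambda>q. exp (f q) * g' q (Y q) (Z q))"
      by (rule tangent_cong[OF pM v W(1,2)])
        (use conf W(3) vector_field_tangent[OF Y] vector_field_tangent[OF Z] in auto)
    also have "\<dots> = exp (f p) * X p f * g' p (Y p) (Z p) + exp (f p) * X p (\<lambda>q. g' q (Y q) (Z q))"
      using tangent_mult[OF v smooth_fun_exp[OF fW] W(2) riemannian_metric_smooth[OF g' W(3) Y Z]]
        tangent_exp[OF v fW W(2)] by simp
    also have "\<dots> = X p f * g p (Y p) (Z p) + g p (D' p (X p) Y) (Z p) + g p (Y p) (D' p (X p) Z)"
      using conf[OF pU tan(1)[OF X Y] tan(3)[OF Z Y]] conf[OF pU tan(3)[OF Y Z] tan(1)[OF X Z]]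
        conf[OF pU tan(3)[OF Y Z] tan(3)[OF Z Y]]
      by (simp add: levi_civita_metric[OF lc' W(3) Y Z W(2) v] algebra_simps)
    finally show ?thesis
      using levi_civita_metric[OF lc WM Y Z W(2) v] tan[OF X Y] tan[OF X Z] tan[OF Y Z] tan[OF Z Y]
      by (simp add: s_def h.g_sym[of "Y p"])
  qed
  \<comment> \<open>Koszul's combination: the relation for \<open>X Y Z\<close> plus that for
    \<open>Y X Z\<close> minus that for \<open>Z X Y\<close>. By symmetry everything except
    \<open>2 * s X Y Z\<close> cancels.\<close>
  have "2 * s X Y Z = - X p f * g p (Y p) (Z p) - Y p f * g p (X p) (Z p) + Z p f * g p (X p) (Y p)"
    using skew[of X Y Z] skew[of Y X Z] skew[of Z X Y] sym[of X Y Z] sym[of X Z Y] sym[of Y Z X] fields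
    by simp
  then show ?thesis by (simp add: s_def at_p)
qed

end

section \<open>Parallel Lee form\<close>

locale parallel_lee_form = smooth_mfd M
  for M :: "('a, 'e::euclidean_space) manifold" +
  fixes g ghat :: "'a bilin" and I1 I2 I3 :: "'a endo" and \<theta> :: "'a kform" and nabla :: "'a connection"
  assumes hh: "hyperhermitian M (points M) g I1 I2 I3"
    and lee: "lee_form M g I1 I2 I3 \<theta>"
    and lc: "levi_civita M (points M) g nabla"
    and parallel: "parallel_1form M (points M) nabla \<theta>"
    and unit: "\<And>p. p \<in> points M \<Longrightarrow> form_norm M g \<theta> p = 1"
    and ghat: "\<And>p v w. ghat p v w = g p v w - 1 / 2 *
      (\<theta> p [v] * \<theta> p [w] + form_act I1 \<theta> p [v] * form_act I1 \<theta> p [w]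
        + form_act I2 \<theta> p [v] * form_act I2 \<theta> p [w] + form_act I3 \<theta> p [v] * form_act I3 \<theta> p [w])"
begin

lemma hermitian: "p \<in> points M \<Longrightarrow> quaternionic_hermitian (T p) (g p) (I1 p) (I2 p) (I3 p)"
  using quaternionic_hermitian_tangent_space[OF smooth_manifold hh] by blast

lemma g_riemannian: "riemannian_metric M (points M) g"
  using hh by (simp add: hyperhermitian_def)

lemma I_field: "I \<in> {I1, I2, I3} \<Longrightarrow> endo_field M (points M) I"
  using hh by (auto simp: hyperhermitian_def hypercomplex_def complex_structure_def)

lemmas nabla_connection = levi_civita_linear_connection[OF lc]

section \<open>The Lee form and its dual vector field\<close>

lemma \<theta>_smooth:
  assumes "vector_field M V X"
  shows "smooth_fun M V (\<lambda>p. \<theta> p [X p])"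
proof -
  have "is_form M (points M) 1 \<theta>" using lee by (simp add: lee_form_def)
  from conjunct2[OF iffD1[OF is_form_def this], rule_format, of V "[X]"] show ?thesis
    using assms openin_subset[OF vector_field_openin[OF assms]] by simp
qed

text \<open>\<open>conformal_change\<close> on a member of the cover. There \<open>\<theta>\<close>
  is the differential of \<open>f\<close>, so \<open>f\<close> and the local metric disappear from
  the formula and only globally defined data remain besides the connection
  \<open>D'\<close>.\<close>

lemma local_hyperkaehler:
  assumes "p \<in> points M"
  obtains U D' where "p \<in> U" "openin (mtop M) U" "linear_connection M U D'"
    "\<forall>I\<in>{I1, I2, I3}. parallel_endo M U D' I"
    "\<forall>V Y p v w. V \<subseteq> U \<longrightarrow> vector_field M V Y \<longrightarrow> p \<in> V \<longrightarrow> v \<in> T p \<longrightarrow> w \<in> T p \<longrightarrow>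
      2 * g p (D' p v Y - nabla p v Y) w =
        - \<theta> p [v] * g p (Y p) w - \<theta> p [Y p] * g p v w + \<theta> p [w] * g p v (Y p)"
proof -
  obtain \<C> where C: "lchk_cover M g I1 I2 I3 \<C>"
    "\<forall>(U, f, g')\<in>\<C>. \<forall>p\<in>U. \<forall>v\<in>T p. \<theta> p [v] = v f"
    using lee unfolding lee_form_def by blast
  have "p \<in> (\<Union>(U, f, g')\<in>\<C>. U)"
    using assms C(1) unfolding lchk_cover_def by simp
  then obtain U f g' where U: "(U, f, g') \<in> \<C>" "p \<in> U" by auto
  have props: "openin (mtop M) U" "smooth_fun M U f" "hyperkaehler M U g' I1 I2 I3"
    "\<And>p v w. p \<in> U \<Longrightarrow> v \<in> T p \<Longrightarrow> w \<in> T p \<Longrightarrow> g p v w = exp (f p) * g' p v w"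
    "\<And>p v. p \<in> U \<Longrightarrow> v \<in> T p \<Longrightarrow> \<theta> p [v] = v f"
    using bspec[OF conjunct2[OF iffD1[OF lchk_cover_def C(1)]] U(1)] bspec[OF C(2) U(1)] by auto
  obtain D' where D': "levi_civita M U g' D'" "\<forall>I\<in>{I1, I2, I3}. parallel_endo M U D' I"
    using props(3) unfolding hyperkaehler_def by blast
  have g': "riemannian_metric M U g'"
    using props(3) by (simp add: hyperkaehler_def hyperhermitian_def)
  show thesis
  proof (rule that[OF U(2) props(1) levi_civita_linear_connection[OF D'(1)] D'(2)],
      intro allI impI)
    fix V Y p v w
    assume *: "V \<subseteq> U" "vector_field M V Y" "p \<in> V" "v \<in> T p" "w \<in> T p"
    with vector_field_tangent[of V Y p] have "\<theta> p [v] = v f" "\<theta> p [w] = w f" "\<theta> p [Y p] = Y p f"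
      by (auto intro!: props(5))
    then show "2 * g p (D' p v Y - nabla p v Y) w =
        - \<theta> p [v] * g p (Y p) w - \<theta> p [Y p] * g p v w + \<theta> p [w] * g p v (Y p)"
      using conformal_change[OF lc D'(1) hermitian g' props(2,4) *] by simp
  qed
qed

text \<open>The Lee field is read off from the difference of the two Levi-Civita connections; this shows
  at once that it exists and that it is smooth.\<close>

lemma lee_field_local:
  assumes "p \<in> points M"
  obtains W X where "p \<in> W" "vector_field M W X"
    "\<forall>q\<in>W. \<forall>w\<in>T q. g q (X q) w = \<theta> q [w]"
proof -
  obtain U D' where U: "p \<in> U" "openin (mtop M) U" "linear_connection M U D'"
    "\<forall>I\<in>{I1, I2, I3}. parallel_endo M U D' I"
    "\<forall>V Y p v w. V \<subseteq> U \<longrightarrow> vector_field M V Y \<longrightarrow> p \<in> V \<longrightarrow> v \<in> T p \<longrightarrow> w \<in> T p \<longrightarrow>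
      2 * g p (D' p v Y - nabla p v Y) w =
        - \<theta> p [v] * g p (Y p) w - \<theta> p [Y p] * g p v w + \<theta> p [w] * g p v (Y p)"
    by (rule local_hyperkaehler[OF assms])
  \<comment> \<open>A nonzero coefficient vector gives a coordinate field without zeros, so that its
    squared length may be divided by.\<close>
  obtain b :: 'e where b: "b \<noteq> 0" using nonempty_Basis nonzero_Basis by blast
  let ?c = "chart_at M p"
  note c = chart_at[OF assms]
  define W where "W = U \<inter> fst ?c"
  define X where "X = (\<lambda>q. coord_vec M ?c q b)"
  have W: "openin (mtop M) W" "W \<subseteq> U" "p \<in> W" "W \<subseteq> points M"
    using U c chart_openin[OF c(1)] openin_subset[of "mtop M" U] by (auto simp: W_def)
  have X: "vector_field M W X"
    using vector_field_subset[OF coord_vec_field[OF c(1)] W(1)] by (simp add: W_def X_def)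
  have pos: "g q (X q) (X q) > 0" if "q \<in> W" for q
  proof -
    interpret h: quaternionic_hermitian "T q" "g q" "I1 q" "I2 q" "I3 q"
      using hermitian W that by blast
    show ?thesis
      using that coord_vec_nonzero[OF c(1) _ b] vector_field_tangent[OF X that]
      by (auto intro!: h.g_pos simp: W_def X_def)
  qed
  \<comment> \<open>With both arguments equal to \<open>X\<close>, the difference formula reads
    \<open>2 g(D'_X X - nabla_X X, w) = - 2 \<theta>(X) g(X,w) + \<theta>(w) g(X,X)\<close>;
    \<open>Z\<close> is obtained by solving for \<open>\<theta>(w)\<close>.\<close>
  define Z where "Z q = inverse (g q (X q) (X q)) *\<^sub>R
    (2 *\<^sub>R (D' q (X q) X - nabla q (X q) X) + (2 * \<theta> q [X q]) *\<^sub>R X q)" for q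
  have "vector_field M W Z"
    unfolding Z_def using pos
    by (intro vector_field_scaleR vector_field_add vector_field_diff smooth_fun_inverse smooth_fun_cmult
        riemannian_metric_smooth[OF g_riemannian W(4)] \<theta>_smooth X smooth_fun_const W(1)
        linear_connection_field[OF U(3) W(2)] linear_connection_field[OF nabla_connection W(4)]) force
  moreover have "g q (Z q) w = \<theta> q [w]" if q: "q \<in> W" and w: "w \<in> T q" for q w
  proof -
    interpret h: quaternionic_hermitian "T q" "g q" "I1 q" "I2 q" "I3 q"
      using hermitian W q by blast
    have T: "X q \<in> T q" "D' q (X q) X \<in> T q" "nabla q (X q) X \<in> T q"
      using vector_field_tangent[OF X q] linear_connection_tangent[OF U(3) W(2) X q]
        linear_connection_tangent[OF nabla_connection W(4) X q] by auto
    show ?thesis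
      using U(5)[rule_format, OF W(2) X q T(1) w] pos[OF q] T w
      by (simp add: Z_def field_simps)
  qed
  ultimately show thesis using that W(3) by blast
qed

definition B where "B = sharp M g \<theta>"

lemma B_eq:
  assumes p: "p \<in> points M" and x: "x \<in> T p" "\<And>w. w \<in> T p \<Longrightarrow> g p x w = \<theta> p [w]"
  shows "B p = x"
proof -
  interpret h: quaternionic_hermitian "T p" "g p" "I1 p" "I2 p" "I3 p" by (rule hermitian[OF p])
  show ?thesis
    unfolding B_def sharp_def by (rule the_equality) (use x h.g_eqI in auto)
qed

text \<open>By uniqueness of the dual vector, \<open>B\<close> coincides with the smooth local
  fields of \<open>lee_field_local\<close>.\<close>

lemma B_field: "vector_field M (points M) B"
proof (rule vector_field_local)
  fix p assume "p \<in> points M"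
  then obtain W X where W: "p \<in> W" "vector_field M W X"
    "\<forall>q\<in>W. \<forall>w\<in>T q. g q (X q) w = \<theta> q [w]"
    using lee_field_local by blast
  then have "B q = X q" if "q \<in> W" for q
    using that by (intro B_eq) (auto dest: vector_field_points vector_field_tangent)
  with W have "vector_field M W B" by (metis vector_field_cong)
  with W show "\<exists>W. p \<in> W \<and> W \<subseteq> points M \<and> vector_field M W B"
    using vector_field_points by blast
qed

lemma B_tangent: "p \<in> points M \<Longrightarrow> B p \<in> T p"
  using vector_field_tangent[OF B_field] .

lemma B_\<theta>:
  assumes "p \<in> points M" "w \<in> T p"
  shows "g p (B p) w = \<theta> p [w]"
proof -
  obtain W X where "p \<in> W" "vector_field M W X"
    "\<forall>q\<in>W. \<forall>w\<in>T q. g q (X q) w = \<theta> q [w]"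
    by (rule lee_field_local[OF assms(1)])
  then show ?thesis using B_eq[OF assms(1), of "X p"] assms(2) vector_field_tangent by metis
qed

lemma hermitian_unit:
  assumes p: "p \<in> points M"
  shows "quaternionic_hermitian_unit (T p) (g p) (I1 p) (I2 p) (I3 p) (B p)"
proof -
  interpret h: quaternionic_hermitian "T p" "g p" "I1 p" "I2 p" "I3 p" by (rule hermitian[OF p])
  show ?thesis
    by unfold_locales (use B_tangent[OF p] unit[OF p] in \<open>auto simp: form_norm_def B_def\<close>)
qed

section \<open>Covariant and exterior derivatives of \<open>\<theta>_r\<close>\<close>

text \<open>The sign of \<open>form_act\<close> on 1-forms cancels the one from skewness of
  \<open>I_r\<close>, so \<open>I_r B\<close> is dual to \<open>\<theta>_r\<close>.\<close>

lemma form_act_\<theta>: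
  assumes p: "p \<in> points M" and v: "v \<in> T p"
  shows "form_act I1 \<theta> p [v] = g p (I1 p (B p)) v" "form_act I2 \<theta> p [v] = g p (I2 p (B p)) v"
    "form_act I3 \<theta> p [v] = g p (I3 p (B p)) v"
proof -
  interpret h: quaternionic_hermitian_unit "T p" "g p" "I1 p" "I2 p" "I3 p" "B p"
    by (rule hermitian_unit[OF p])
  show "form_act I1 \<theta> p [v] = g p (I1 p (B p)) v" "form_act I2 \<theta> p [v] = g p (I2 p (B p)) v"
    "form_act I3 \<theta> p [v] = g p (I3 p (B p)) v"
    using v by (simp_all add: form_act_def B_\<theta>[OF p, symmetric] h.g_I_right)
qed

text \<open>Near \<open>p\<close> some \<open>D'\<close> has \<open>I\<close> parallel. Writing both
  sides of \<open>D'(I Y) = I (D' Y)\<close> through \<open>nabla\<close> gives the formula; the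
  terms with \<open>\<theta> p [v]\<close> cancel.\<close>

lemma nabla_I:
  assumes I: "I \<in> {I1, I2, I3}" and Y: "vector_field M V Y" and p: "p \<in> V" and v: "v \<in> T p"
  shows "nabla p v (\<lambda>q. I q (Y q)) = I p (nabla p v Y) + (1 / 2) *\<^sub>R (\<theta> p [I p (Y p)] *\<^sub>R v
    - \<theta> p [Y p] *\<^sub>R I p v - g p v (I p (Y p)) *\<^sub>R B p + g p v (Y p) *\<^sub>R I p (B p))"
proof -
  have pM: "p \<in> points M" using vector_field_points[OF Y p] .
  interpret h: quaternionic_hermitian_unit "T p" "g p" "I1 p" "I2 p" "I3 p" "B p"
    by (rule hermitian_unit[OF pM])
  obtain U D' where U: "p \<in> U" "openin (mtop M) U" "linear_connection M U D'"
    "\<forall>I\<in>{I1, I2, I3}. parallel_endo M U D' I"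
    "\<forall>V Y p v w. V \<subseteq> U \<longrightarrow> vector_field M V Y \<longrightarrow> p \<in> V \<longrightarrow> v \<in> T p \<longrightarrow> w \<in> T p \<longrightarrow>
      2 * g p (D' p v Y - nabla p v Y) w =
        - \<theta> p [v] * g p (Y p) w - \<theta> p [Y p] * g p v w + \<theta> p [w] * g p v (Y p)"
    by (rule local_hyperkaehler[OF pM])
  define W where "W = V \<inter> U"
  have W: "openin (mtop M) W" "p \<in> W" "W \<subseteq> V" "W \<subseteq> U" "W \<subseteq> points M"
    using vector_field_openin[OF Y] U p openin_subset[of "mtop M" U] by (auto simp: W_def)
  have YW: "vector_field M W Y" using vector_field_subset[OF Y W(1,3)] .
  have IY: "vector_field M W (\<lambda>q. I q (Y q))"
    using endo_field_vector_field[OF I_field[OF I] W(5) YW] .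
  \<comment> \<open>Nondegeneracy of \<open>g\<close> turns the tested difference formula into an
    equation of vectors.\<close>
  have eq: "D' p v Z = nabla p v Z + (1 / 2) *\<^sub>R (g p v (Z p) *\<^sub>R B p - \<theta> p [v] *\<^sub>R Z p - \<theta> p [Z p] *\<^sub>R v)"
    if Z: "vector_field M W Z" for Z
  proof (rule h.g_eqI)
    have *: "D' p v Z \<in> T p" "nabla p v Z \<in> T p" "Z p \<in> T p"
      using linear_connection_tangent[OF U(3) W(4) Z W(2) v]
        linear_connection_tangent[OF nabla_connection W(5) Z W(2) v] vector_field_tangent[OF Z W(2)] by auto
    then show "D' p v Z \<in> T p"
      "nabla p v Z + (1 / 2) *\<^sub>R (g p v (Z p) *\<^sub>R B p - \<theta> p [v] *\<^sub>R Z p - \<theta> p [Z p] *\<^sub>R v) \<in> T p"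
      using v by simp_all
    fix u assume u: "u \<in> T p"
    show "g p (D' p v Z) u =
      g p (nabla p v Z + (1 / 2) *\<^sub>R (g p v (Z p) *\<^sub>R B p - \<theta> p [v] *\<^sub>R Z p - \<theta> p [Z p] *\<^sub>R v)) u"
      using U(5)[rule_format, OF W(4) Z W(2) v u] * u v by (simp add: B_\<theta>[OF pM] field_simps)
  qed
  have "D' p v (\<lambda>q. I q (Y q)) = I p (D' p v Y)"
    using U(4)[rule_format, OF I] W YW v unfolding parallel_endo_def by blast
  moreover have "Y p \<in> T p" "nabla p v Y \<in> T p"
    using vector_field_tangent[OF Y p] linear_connection_tangent[OF nabla_connection W(5) YW W(2) v] by auto
  ultimately show ?thesis
    using I v eq[OF YW] eq[OF IY] by (auto simp: algebra_simps)
qed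

lemma \<theta>_deriv:
  assumes "vector_field M V X" "p \<in> V" "v \<in> T p"
  shows "v (\<lambda>q. \<theta> q [X q]) = \<theta> p [nabla p v X]"
  using parallel assms vector_field_points[OF assms(1)] unfolding parallel_1form_def by blast

lemma form_act_smooth:
  assumes "I \<in> {I1, I2, I3}" "vector_field M V X"
  shows "smooth_fun M V (\<lambda>q. form_act I \<theta> q [X q])"
proof -
  have "vector_field M V (\<lambda>q. I q (X q))"
    using endo_field_vector_field[OF I_field[OF assms(1)] _ assms(2)] vector_field_points[OF assms(2)] by blast
  then show ?thesis
    by (auto simp: form_act_def intro: smooth_fun_minus \<theta>_smooth)
qed

text \<open>Since \<open>\<theta>\<close> is parallel, only the defect from \<open>nabla_I\<close>
  contributes. Applying \<open>- \<theta>\<close> to it and using \<open>\<theta>(B) = 1\<close> and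
  \<open>\<theta>(I B) = 0\<close> leaves \<open>dt\<close>.\<close>

lemma form_act_deriv:
  assumes I: "I \<in> {I1, I2, I3}" and X: "vector_field M V X" and p: "p \<in> V" and v: "v \<in> T p"
  shows "v (\<lambda>q. form_act I \<theta> q [X q]) = form_act I \<theta> p [nabla p v X] +
    quaternionic_hermitian_unit.dt (g p) (B p) (I p) v (X p)"
proof -
  have pM: "p \<in> points M" using vector_field_points[OF X p] .
  interpret h: quaternionic_hermitian_unit "T p" "g p" "I1 p" "I2 p" "I3 p" "B p"
    by (rule hermitian_unit[OF pM])
  have VM: "V \<subseteq> points M" using vector_field_points[OF X] by blast
  have IX: "vector_field M V (\<lambda>q. I q (X q))"
    using endo_field_vector_field[OF I_field[OF I] VM X] .
  have T: "X p \<in> T p" "nabla p v X \<in> T p"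
    using vector_field_tangent[OF X p] linear_connection_tangent[OF nabla_connection VM X p v] by auto
  have "v (\<lambda>q. form_act I \<theta> q [X q]) = - \<theta> p [nabla p v (\<lambda>q. I q (X q))]"
    using tangent_minus[OF v \<theta>_smooth[OF IX] p] \<theta>_deriv[OF IX p v] by (simp add: form_act_def)
  also have "\<dots> = form_act I \<theta> p [nabla p v X] + h.dt (I p) v (X p)"
    unfolding nabla_I[OF I X p v] form_act_def using I T v
    by (auto simp: B_\<theta>[OF pM, symmetric] h.dt_def h.g_I_right field_simps)
  finally show ?thesis .
qed

text \<open>Coordinate vector fields commute, so a torsion-free connection computes the exterior
  derivative.\<close>

lemma nabla_coord_extension:
  assumes p: "p \<in> points M" and v: "v \<in> T p" and w: "w \<in> T p"
  shows "nabla p v (coord_extension M p w) = nabla p w (coord_extension M p v)"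
proof -
  have "fst (chart_at M p) \<subseteq> points M"
    using chart_openin[OF chart_at(1)[OF p]] openin_subset by blast
  from levi_civita_torsion[OF lc this coord_extension_field[OF p v] coord_extension_field[OF p w] chart_at(2)[OF p]]
  show ?thesis
    using lie_bracket_coord_extension[OF p v w] by (simp add: coord_extension_self p v w)
qed

lemma ext_deriv_minus_\<theta>:
  assumes p: "p \<in> points M" and v: "v \<in> T p" and w: "w \<in> T p"
  shows "ext_deriv M (- \<theta>) p [v, w] = 0"
proof -
  note c = chart_at[OF p]
  have *: "u (\<lambda>q. (- \<theta>) q [coord_extension M p x q]) = - \<theta> p [nabla p u (coord_extension M p x)]"
    if "u \<in> T p" "x \<in> T p" for u x
    using tangent_minus[OF that(1) \<theta>_smooth[OF coord_extension_field[OF p that(2)]] c(2)]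
      \<theta>_deriv[OF coord_extension_field[OF p that(2)] c(2) that(1)] by simp
  show ?thesis
    using *[OF v w] *[OF w v] nabla_coord_extension[OF p v w] by (simp add: ext_deriv_1form)
qed

text \<open>The connection terms cancel by \<open>nabla_coord_extension\<close>, leaving the skew
  part of \<open>dt\<close>. The form \<open>\<omega>\<close> is only required to agree with
  \<open>- \<theta>_r\<close> on tangent vectors, because the lemma is also applied to twice
  transformed forms such as \<open>I2 (I3 (- \<theta>))\<close>.\<close>

lemma ext_deriv_form_act:
  assumes I: "I \<in> {I1, I2, I3}" and p: "p \<in> points M" and v: "v \<in> T p" and w: "w \<in> T p"
    and \<omega>: "\<And>q u. q \<in> points M \<Longrightarrow> u \<in> T q \<Longrightarrow> \<omega> q [u] = - form_act I \<theta> q [u]"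
  shows "ext_deriv M \<omega> p [v, w] =
    g p (I p v) w - (g p (B p) v * g p (I p (B p)) w - g p (I p (B p)) v * g p (B p) w)"
proof -
  note c = chart_at[OF p]
  interpret h: quaternionic_hermitian_unit "T p" "g p" "I1 p" "I2 p" "I3 p" "B p"
    by (rule hermitian_unit[OF p])
  have *: "u (\<lambda>q. \<omega> q [coord_extension M p x q]) =
      - (form_act I \<theta> p [nabla p u (coord_extension M p x)] + h.dt (I p) u x)"
    if "u \<in> T p" "x \<in> T p" for u x
  proof -
    note X = coord_extension_field[OF p that(2)]
    have "u (\<lambda>q. \<omega> q [coord_extension M p x q]) = u (\<lambda>q. - form_act I \<theta> q [coord_extension M p x q])"
      using vector_field_tangent[OF X] vector_field_points[OF X] \<omega>
      by (intro tangent_cong[OF p that(1) vector_field_openin[OF X] c(2)]) blast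
    then show ?thesis
      using tangent_minus[OF that(1) form_act_smooth[OF I X] c(2)] form_act_deriv[OF I X c(2) that(1)]
      by (simp add: coord_extension_self p that)
  qed
  have "ext_deriv M \<omega> p [v, w] = h.dt (I p) w v - h.dt (I p) v w"
    using *[OF v w] *[OF w v] nabla_coord_extension[OF p v w] by (simp add: ext_deriv_1form)
  also have "g p (I p w) v = - g p (I p v) w"
    using I v w h.g_I_swap[of w v] by auto
  ultimately show ?thesis by (simp add: h.dt_def field_simps)
qed

section \<open>The HKT connection and the potential\<close>

abbreviation gh where "gh p \<equiv> quaternionic_hermitian_unit.gh (g p) (I1 p) (I2 p) (I3 p) (B p)"
abbreviation A where "A p \<equiv> quaternionic_hermitian_unit.A (g p) (I1 p) (I2 p) (I3 p) (B p)"

section \<open>The metric \<open>ghat\<close>\<close>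

lemma ghat_eq:
  assumes "p \<in> points M" "v \<in> T p" "w \<in> T p"
  shows "ghat p v w = gh p v w"
  using assms
  by (simp add: ghat quaternionic_hermitian_unit.gh_def[OF hermitian_unit] form_act_\<theta> B_\<theta>)

lemma ghat_smooth:
  assumes X: "vector_field M V X" and Y: "vector_field M V Y"
  shows "smooth_fun M V (\<lambda>p. ghat p (X p) (Y p))"
proof -
  have "V \<subseteq> points M" using vector_field_points[OF X] by blast
  then show ?thesis
    unfolding ghat
    by (intro smooth_fun_diff smooth_fun_cmult smooth_fun_add smooth_fun_mult
        riemannian_metric_smooth[OF g_riemannian _ X Y] \<theta>_smooth form_act_smooth X Y) auto
qed

lemma ghat_hyperhermitian: "hyperhermitian M (points M) ghat I1 I2 I3"
  unfolding hyperhermitian_def riemannian_metric_def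
proof (intro conjI ballI allI impI)
  show "hypercomplex M (points M) I1 I2 I3"
    using hh by (simp add: hyperhermitian_def)
  fix p v assume p: "p \<in> points M" and v: "v \<in> T p"
  interpret h: quaternionic_hermitian_unit "T p" "g p" "I1 p" "I2 p" "I3 p" "B p"
    by (rule hermitian_unit[OF p])
  show "linear_on_subspace (T p) (ghat p v)"
    using linear_on_subspace_cong[OF h.S, of "ghat p v" "h.gh v"] ghat_eq[OF p v] h.gh_linear[OF v] by blast
  show "ghat p v w = ghat p w v" if "w \<in> T p" for w
    using that v h.gh_sym by (simp add: ghat_eq[OF p])
  show "0 < ghat p v v" if "v \<noteq> 0"
    using that v h.gh_pos by (simp add: ghat_eq[OF p])
  show "ghat p (I p v) (I p w) = ghat p v w" if "I \<in> {I1, I2, I3}" "w \<in> T p" for I w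
    using that v h.gh_I by (auto simp: ghat_eq[OF p])
qed (use ghat_smooth in blast)

lemma A_field:
  assumes X: "vector_field M V X" and Y: "vector_field M V Y"
  shows "vector_field M V (\<lambda>p. A p (X p) (Y p))"
proof -
  have VM: "V \<subseteq> points M" using vector_field_points[OF X] by blast
  have oV: "openin (mtop M) V" using vector_field_openin[OF X] .
  have BV: "vector_field M V (\<lambda>q. B q)" using vector_field_subset[OF B_field oV VM] .
  note I = endo_field_vector_field[OF I_field VM]
  note fields = X Y BV I[of I1, OF _ X, simplified] I[of I2, OF _ X, simplified] I[of I3, OF _ X, simplified]
    I[of I1, OF _ BV, simplified] I[of I2, OF _ BV, simplified] I[of I3, OF _ BV, simplified]
  \<comment> \<open>The defining equation of \<open>A\<close> is available only at points of the
    manifold, so smoothness is shown for the expanded expression and transferred by agreement on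
    \<open>V\<close>.\<close>
  show ?thesis
  proof (rule vector_field_cong)
    show "vector_field M V (\<lambda>p. (1 / 2) *\<^sub>R
     (g p (I1 p (B p)) (Y p) *\<^sub>R I1 p (X p) + g p (I2 p (B p)) (Y p) *\<^sub>R I2 p (X p)
     + g p (I3 p (B p)) (Y p) *\<^sub>R I3 p (X p)
     + (g p (I1 p (B p)) (X p) * g p (I1 p (B p)) (Y p) + g p (I2 p (B p)) (X p) * g p (I2 p (B p)) (Y p)
        + g p (I3 p (B p)) (X p) * g p (I3 p (B p)) (Y p)) *\<^sub>R B p
     + (g p (I2 p (B p)) (X p) * g p (I3 p (B p)) (Y p) - g p (I3 p (B p)) (X p) * g p (I2 p (B p)) (Y p)
        - g p (I1 p (B p)) (X p) * g p (B p) (Y p) - g p (I1 p (X p)) (Y p)) *\<^sub>R I1 p (B p)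
     + (g p (I3 p (B p)) (X p) * g p (I1 p (B p)) (Y p) - g p (I1 p (B p)) (X p) * g p (I3 p (B p)) (Y p)
        - g p (I2 p (B p)) (X p) * g p (B p) (Y p) - g p (I2 p (X p)) (Y p)) *\<^sub>R I2 p (B p)
     + (g p (I1 p (B p)) (X p) * g p (I2 p (B p)) (Y p) - g p (I2 p (B p)) (X p) * g p (I1 p (B p)) (Y p)
        - g p (I3 p (B p)) (X p) * g p (B p) (Y p) - g p (I3 p (X p)) (Y p)) *\<^sub>R I3 p (B p)))"
      by (intro vector_field_cscaleR vector_field_add vector_field_scaleR smooth_fun_add smooth_fun_diff
          smooth_fun_mult riemannian_metric_smooth[OF g_riemannian VM] fields)
  qed (use VM quaternionic_hermitian_unit.A_def[OF hermitian_unit] in auto)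
qed

section \<open>The HKT connection\<close>

definition D where "D p v Y = nabla p v Y + A p v (Y p)"

lemma torsion_D:
  assumes "vector_field M V X" "vector_field M V Y" "p \<in> V"
  shows "torsion M D X Y p = A p (X p) (Y p) - A p (Y p) (X p)"
proof -
  have "V \<subseteq> points M" using vector_field_points[OF assms(1)] by blast
  from levi_civita_torsion[OF lc this assms] show ?thesis
    by (simp add: torsion_def D_def algebra_simps)
qed

text \<open>\<open>A\<close> is tensorial: it involves \<open>Y\<close> only through the value
  \<open>Y p\<close>, and linearly. Adding it to \<open>nabla\<close> therefore preserves the
  Leibniz rule and locality.\<close>

lemma D_linear_connection: "linear_connection M (points M) D"
  unfolding linear_connection_def
proof (intro conjI allI impI ballI; elim conjE)
  fix V X Y assume V: "V \<subseteq> points M" "vector_field M V X" "vector_field M V Y"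
  then show "vector_field M V (\<lambda>p. D p (X p) Y)"
    unfolding D_def by (intro vector_field_add linear_connection_field[OF nabla_connection] A_field)
next
  fix V Y p assume V: "V \<subseteq> points M" "vector_field M V Y" and p: "p \<in> V"
  then have pM: "p \<in> points M" by blast
  interpret h: quaternionic_hermitian_unit "T p" "g p" "I1 p" "I2 p" "I3 p" "B p"
    by (rule hermitian_unit[OF pM])
  note Yp = vector_field_tangent[OF V(2) p]
  show "linear_on_subspace (T p) (\<lambda>v. D p v Y)"
    using linear_connection_linear[OF nabla_connection V p] h.A_linear_left[OF Yp]
    unfolding linear_on_subspace_def D_def by (simp add: algebra_simps)
  fix v assume v: "v \<in> T p"
  show "D p v Y \<in> T p"
    using linear_connection_tangent[OF nabla_connection V p v] Yp v by (simp add: D_def)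
  note A = linear_on_subspaceD[OF h.A_linear_right[OF v]]
  show "D p v (Y + Z) = D p v Y + D p v Z" if Z: "vector_field M V Z" for Z
    using linear_connection_add[OF nabla_connection V Z p v] A(1)[OF Yp vector_field_tangent[OF Z p]]
    by (simp add: D_def)
  show "D p v (\<lambda>q. f q *\<^sub>R Y q) = v f *\<^sub>R Y p + f p *\<^sub>R D p v Y" if f: "smooth_fun M V f" for f
    using linear_connection_leibniz[OF nabla_connection V(1) f V(2) p v] A(2)[OF Yp]
    by (simp add: D_def algebra_simps)
  show "D p v Y = D p v Z" if Z: "vector_field M V Z" "\<forall>q\<in>V. Y q = Z q" for Z
    using linear_connection_cong[OF nabla_connection V Z p v] Z(2) p by (simp add: D_def)
qed

lemma D_metric: "parallel_metric M (points M) D ghat"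
  unfolding parallel_metric_def
proof (intro allI impI ballI; elim conjE)
  fix V X Y p v
  assume V: "V \<subseteq> points M" and X: "vector_field M V X" and Y: "vector_field M V Y"
    and p: "p \<in> V" and v: "v \<in> T p"
  then have pM: "p \<in> points M" by blast
  interpret h: quaternionic_hermitian_unit "T p" "g p" "I1 p" "I2 p" "I3 p" "B p"
    by (rule hermitian_unit[OF pM])
  let ?N = "\<lambda>X. nabla p v X"
  have tan: "X p \<in> T p" "Y p \<in> T p" "?N X \<in> T p" "?N Y \<in> T p"
    using vector_field_tangent[OF X p] vector_field_tangent[OF Y p]
      linear_connection_tangent[OF nabla_connection V X p v] linear_connection_tangent[OF nabla_connection V Y p v] by auto
  note \<theta> = \<theta>_smooth[OF X] \<theta>_smooth[OF Y]
  note \<theta>1 = form_act_smooth[of I1, OF _ X, simplified] form_act_smooth[of I1, OF _ Y, simplified]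
  note \<theta>2 = form_act_smooth[of I2, OF _ X, simplified] form_act_smooth[of I2, OF _ Y, simplified]
  note \<theta>3 = form_act_smooth[of I3, OF _ X, simplified] form_act_smooth[of I3, OF _ Y, simplified]
  \<comment> \<open>The derivation rules ask for smoothness of every product and partial sum, so
    these are collected in the order in which \<open>ghat\<close> is built.\<close>
  note prod = smooth_fun_mult[OF \<theta>] smooth_fun_mult[OF \<theta>1] smooth_fun_mult[OF \<theta>2] smooth_fun_mult[OF \<theta>3]
  note sum2 = smooth_fun_add[OF prod(1,2)]
  note sum3 = smooth_fun_add[OF sum2 prod(3)]
  note sum4 = smooth_fun_add[OF sum3 prod(4)]
  have "v (\<lambda>q. ghat q (X q) (Y q)) = g p (?N X) (Y p) + g p (X p) (?N Y) - 1 / 2 *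
      (\<theta> p [?N X] * \<theta> p [Y p] + \<theta> p [X p] * \<theta> p [?N Y]
      + v (\<lambda>q. form_act I1 \<theta> q [X q]) * form_act I1 \<theta> p [Y p] + form_act I1 \<theta> p [X p] * v (\<lambda>q. form_act I1 \<theta> q [Y q])
      + v (\<lambda>q. form_act I2 \<theta> q [X q]) * form_act I2 \<theta> p [Y p] + form_act I2 \<theta> p [X p] * v (\<lambda>q. form_act I2 \<theta> q [Y q])
      + v (\<lambda>q. form_act I3 \<theta> q [X q]) * form_act I3 \<theta> p [Y p] + form_act I3 \<theta> p [X p] * v (\<lambda>q. form_act I3 \<theta> q [Y q]))"
    unfolding ghat
    by (simp only: tangent_diff[OF v riemannian_metric_smooth[OF g_riemannian V X Y] p smooth_fun_cmult[OF sum4]]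
        tangent_cmult[OF v sum4 p] tangent_add[OF v sum3 p prod(4)] tangent_add[OF v sum2 p prod(3)]
        tangent_add[OF v prod(1) p prod(2)] tangent_mult[OF v \<theta>(1) p \<theta>(2)] tangent_mult[OF v \<theta>1(1) p \<theta>1(2)]
        tangent_mult[OF v \<theta>2(1) p \<theta>2(2)] tangent_mult[OF v \<theta>3(1) p \<theta>3(2)]
        levi_civita_metric[OF lc V X Y p v] \<theta>_deriv[OF X p v] \<theta>_deriv[OF Y p v]) (simp only: add.assoc)
  \<comment> \<open>The derivatives of \<open>\<theta>_r\<close> each bring in a \<open>dt\<close>
    term; together these make up \<open>dgh\<close>, which \<open>gh_A_metric\<close> then converts
    into the \<open>A\<close> part of \<open>D\<close>.\<close>
  also have "\<dots> = h.gh (?N X) (Y p) + h.gh (X p) (?N Y) + h.dgh v (X p) (Y p)"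
    using tan by (simp add: form_act_deriv[OF _ X p v] form_act_deriv[OF _ Y p v] form_act_\<theta>[OF pM]
        B_\<theta>[OF pM, symmetric] h.gh_def h.dgh_def field_simps)
  also have "\<dots> = ghat p (D p v X) (Y p) + ghat p (X p) (D p v Y)"
    using tan v h.gh_A_metric[OF v tan(1,2)] by (simp add: D_def ghat_eq[OF pM])
  finally show "v (\<lambda>q. ghat q (X q) (Y q)) = ghat p (D p v X) (Y p) + ghat p (X p) (D p v Y)" .
qed

lemma D_I:
  assumes I: "I \<in> {I1, I2, I3}"
  shows "parallel_endo M (points M) D I"
  unfolding parallel_endo_def
proof (intro allI impI ballI; elim conjE)
  fix V Y p v
  assume V: "V \<subseteq> points M" and Y: "vector_field M V Y" and p: "p \<in> V" and v: "v \<in> T p"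
  then have pM: "p \<in> points M" by blast
  interpret h: quaternionic_hermitian_unit "T p" "g p" "I1 p" "I2 p" "I3 p" "B p"
    by (rule hermitian_unit[OF pM])
  note Yp = vector_field_tangent[OF Y p]
  have IY: "I p (Y p) \<in> T p" using I Yp by auto
  have "A p v (I p (Y p)) = I p (A p v (Y p)) - (1 / 2) *\<^sub>R (\<theta> p [I p (Y p)] *\<^sub>R v
      - \<theta> p [Y p] *\<^sub>R I p v - g p v (I p (Y p)) *\<^sub>R B p + g p v (Y p) *\<^sub>R I p (B p))"
    using I h.A_I[OF v Yp] unfolding B_\<theta>[OF pM IY, symmetric] B_\<theta>[OF pM Yp, symmetric]
    by (auto simp: algebra_simps)
  then show "D p v (\<lambda>q. I q (Y q)) = I p (D p v Y)"
    using I v Yp linear_connection_tangent[OF nabla_connection V Y p v]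
    unfolding D_def nabla_I[OF I Y p v] by auto
qed

section \<open>The torsion 3-form\<close>

text \<open>On tangent vectors this is the pointwise \<open>c\<close>. It is written with
  \<open>ghat\<close> and \<open>A\<close> so that \<open>ghat_smooth\<close> and
  \<open>A_field\<close> give its smoothness.\<close>

definition torsion_form :: "'a kform" where
  "torsion_form p vs =
     ghat p (A p (vs ! 0) (vs ! 1) - A p (vs ! 1) (vs ! 0)) (vs ! 2)"

lemma torsion_form_is_form: "is_form M (points M) 3 torsion_form"
  unfolding is_form_def
proof (intro conjI ballI allI impI; elim conjE)
  fix p and vs :: "'a tvec list"
  assume p: "p \<in> points M" and len: "length vs = 3" and set: "set vs \<subseteq> T p"
  interpret h: quaternionic_hermitian_unit "T p" "g p" "I1 p" "I2 p" "I3 p" "B p"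
    by (rule hermitian_unit[OF p])
  from len obtain a b d where vs: "vs = [a, b, d]"
    by (auto simp: length_Suc_conv numeral_3_eq_3)
  with set have abd: "a \<in> T p" "b \<in> T p" "d \<in> T p" by auto
  have c_eq: "torsion_form p [a, b, d] = h.c a b d" if "a \<in> T p" "b \<in> T p" "d \<in> T p" for a b d
    using that by (simp add: torsion_form_def h.c_def ghat_eq[OF p])
  show "linear_on_subspace (T p) (\<lambda>v. torsion_form p (vs[i := v]))" if "i < 3" for i
  proof -
    have "i = 0 \<or> i = 1 \<or> i = 2" using that by auto
    then show ?thesis
      using h.c_linear(1)[OF abd(2,3)] h.c_linear(2)[OF abd(1,3)] h.c_linear(3)[OF abd(1,2)] abd
      by (auto simp: vs numeral_2_eq_2 c_eq linear_on_subspace_def)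
  qed
  show "torsion_form p vs = 0" if "i < 3" "j < 3" "i \<noteq> j" "vs ! i = vs ! j" for i j
  proof -
    have "a = b \<or> b = d \<or> a = d"
      using that by (auto simp: vs numeral_3_eq_3 less_Suc_eq)
    then show ?thesis using abd h.c_alternating by (auto simp: vs c_eq)
  qed
next
  fix V and Xs :: "'a vfield list"
  assume V: "V \<subseteq> points M" and len: "length Xs = 3" and fields: "\<forall>X\<in>set Xs. vector_field M V X"
  from len obtain X Y Z where Xs: "Xs = [X, Y, Z]"
    by (auto simp: length_Suc_conv numeral_3_eq_3)
  with fields show "smooth_fun M V (\<lambda>p. torsion_form p (map (\<lambda>X. X p) Xs))"
    by (auto simp: torsion_form_def intro!: ghat_smooth vector_field_diff A_field)
qed

lemma D_hkt: "hkt_connection M ghat I1 I2 I3 D"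
  unfolding hkt_connection_def
proof (intro conjI ballI exI[of _ torsion_form] allI impI)
  show "torsion_form p [X p, Y p, Z p] = ghat p (torsion M D X Y p) (Z p)"
    if "V \<subseteq> points M \<and> vector_field M V X \<and> vector_field M V Y \<and> vector_field M V Z" "p \<in> V"
    for V X Y Z p
    using that by (simp add: torsion_form_def torsion_D[of V X Y p])
qed (use D_linear_connection D_metric D_I torsion_form_is_form in auto)

section \<open>The closed potential 1-form\<close>

lemma minus_\<theta>_form: "is_form M (points M) 1 (- \<theta>)"
proof -
  have form: "is_form M (points M) 1 \<theta>" using lee by (simp add: lee_form_def)
  show ?thesis
    unfolding is_form_def
  proof (intro conjI ballI allI impI; elim conjE)
    fix p and vs :: "'a tvec list" and i
    assume p: "p \<in> points M" and vs: "length vs = 1" "set vs \<subseteq> T p" and i: "i < (1::nat)"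
    then have "linear_on_subspace (T p) (\<lambda>v. \<theta> p (vs[i := v]))"
      using conjunct1[OF iffD1[OF is_form_def form]] by blast
    then show "linear_on_subspace (T p) (\<lambda>v. (- \<theta>) p (vs[i := v]))"
      by (simp add: linear_on_subspace_def)
  next
    fix V and Xs :: "'a vfield list"
    assume "V \<subseteq> points M" "length Xs = 1" "\<forall>X\<in>set Xs. vector_field M V X"
    then have "smooth_fun M V (\<lambda>p. \<theta> p (map (\<lambda>X. X p) Xs))"
      using conjunct2[OF iffD1[OF is_form_def form]] by blast
    then show "smooth_fun M V (\<lambda>p. (- \<theta>) p (map (\<lambda>X. X p) Xs))"
      by (simp add: smooth_fun_minus)
  qed auto
qed

lemma minus_\<theta>_closed: "closed_form M (points M) 1 (- \<theta>)"
  unfolding closed_form_def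
proof (intro conjI ballI allI impI minus_\<theta>_form; elim conjE)
  fix p and vs :: "'a tvec list"
  assume p: "p \<in> points M" and vs: "length vs = Suc 1" "set vs \<subseteq> T p"
  then obtain v w where "vs = [v, w]" by (auto simp: length_Suc_conv)
  with p vs show "ext_deriv M (- \<theta>) p vs = 0" by (simp add: ext_deriv_minus_\<theta>)
qed

lemma minus_\<theta>_potential: "potential_1form M ghat I1 I2 I3 (- \<theta>)"
proof -
  have forms: "form_act I (- \<theta>) q [u] = - form_act I \<theta> q [u]" for I q u
    by (simp add: form_act_def)
  \<comment> \<open>The action on 1-forms reverses composition, and
    \<open>I3 (I2 u) = - I1 u\<close>; hence \<open>I2 (I3 \<omega>) = I1 \<omega>\<close> on
    tangent vectors, and cyclically. So \<open>d_2 \<omega>_3\<close> also reduces to the exterior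
    derivative of \<open>\<omega>_1\<close>.\<close>
  have forms2: "form_act I2 (form_act I3 (- \<theta>)) q [u] = - form_act I1 \<theta> q [u]"
    "form_act I3 (form_act I1 (- \<theta>)) q [u] = - form_act I2 \<theta> q [u]"
    "form_act I1 (form_act I2 (- \<theta>)) q [u] = - form_act I3 \<theta> q [u]"
    if q: "q \<in> points M" and u: "u \<in> T q" for q u
  proof -
    interpret h: quaternionic_hermitian_unit "T q" "g q" "I1 q" "I2 q" "I3 q" "B q"
      by (rule hermitian_unit[OF q])
    show "form_act I2 (form_act I3 (- \<theta>)) q [u] = - form_act I1 \<theta> q [u]"
      "form_act I3 (form_act I1 (- \<theta>)) q [u] = - form_act I2 \<theta> q [u]"
      "form_act I1 (form_act I2 (- \<theta>)) q [u] = - form_act I3 \<theta> q [u]"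
      using u by (simp_all add: form_act_def B_\<theta>[OF q, symmetric])
  qed
  \<comment> \<open>For a 1-form the outer sign is -1, while the action on the resulting 2-form has
    sign \<open>(-1)^2 = 1\<close>. \<open>Suc 0\<close> is the form to which simp brings the degree
    1.\<close>
  have tw: "twisted_deriv M I (Suc 0) \<omega> p [v, w] = - ext_deriv M (form_act I \<omega>) p [I p v, I p w]" for I \<omega> p v w
    by (simp add: twisted_deriv_def form_act_def)
  show ?thesis
    unfolding potential_1form_def Let_def
  proof (intro conjI ballI minus_\<theta>_form)
    fix p v w assume p: "p \<in> points M" and v: "v \<in> T p" and w: "w \<in> T p"
    interpret h: quaternionic_hermitian_unit "T p" "g p" "I1 p" "I2 p" "I3 p" "B p"
      by (rule hermitian_unit[OF p])
    have d: "ext_deriv M (form_act I (- \<theta>)) p [v, w] =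
        g p (I p v) w - (h.t v * g p (I p (B p)) w - g p (I p (B p)) v * h.t w)"
      if "I \<in> {I1, I2, I3}" for I
      by (rule ext_deriv_form_act[OF that p v w forms])
    have d2: "ext_deriv M (form_act I2 (form_act I3 (- \<theta>))) p [x, y] =
        g p (I1 p x) y - (h.t x * h.t1 y - h.t1 x * h.t y)"
      "ext_deriv M (form_act I3 (form_act I1 (- \<theta>))) p [x, y] =
        g p (I2 p x) y - (h.t x * h.t2 y - h.t2 x * h.t y)"
      "ext_deriv M (form_act I1 (form_act I2 (- \<theta>))) p [x, y] =
        g p (I3 p x) y - (h.t x * h.t3 y - h.t3 x * h.t y)"
      if "x \<in> T p" "y \<in> T p" for x y
      using that forms2
      by (intro ext_deriv_form_act[OF _ p]; simp)+
    \<comment> \<open>The twisted term contributes a second copy of \<open>g (I_r v) w\<close> and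
      the complementary wedge product, so half of the sum is the expression in
      \<open>gh_fundamental\<close>.\<close>
    show "fundamental_form ghat I1 p [v, w] = (ext_deriv M (form_act I1 (- \<theta>)) p [v, w] +
        twisted_deriv M I2 1 (form_act I3 (- \<theta>)) p [v, w]) / 2"
      and "fundamental_form ghat I2 p [v, w] = (ext_deriv M (form_act I2 (- \<theta>)) p [v, w] +
        twisted_deriv M I3 1 (form_act I1 (- \<theta>)) p [v, w]) / 2"
      and "fundamental_form ghat I3 p [v, w] = (ext_deriv M (form_act I3 (- \<theta>)) p [v, w] +
        twisted_deriv M I1 1 (form_act I2 (- \<theta>)) p [v, w]) / 2"
      using v w
      by (simp_all add: d d2 tw fundamental_form_def ghat_eq[OF p] h.gh_fundamental h.g_I_right field_simps)
  qed
qed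

end

theorem theorem14:
  fixes M :: "('a, 'e::euclidean_space) manifold"
    and g ghat :: "'a bilin"
    and I1 I2 I3 :: "'a endo"
    and \<theta> \<theta>1 \<theta>2 \<theta>3 :: "'a kform"
    and nabla :: "'a connection"
  assumes lchk: "lchk_manifold M g I1 I2 I3"
    and lee: "lee_form M g I1 I2 I3 \<theta>"
    and lc: "levi_civita M (points M) g nabla"
    and parallel: "parallel_1form M (points M) nabla \<theta>"
    and unit: "\<And>p. p \<in> points M \<Longrightarrow> form_norm M g \<theta> p = 1"
    and theta1: "\<theta>1 = form_act I1 \<theta>"
    and theta2: "\<theta>2 = form_act I2 \<theta>"
    and theta3: "\<theta>3 = form_act I3 \<theta>"
    and ghat: "\<And>p v w. ghat p v w = g p v w - 1 / 2 *
      (\<theta> p [v] * \<theta> p [w] + \<theta>1 p [v] * \<theta>1 p [w] + \<theta>2 p [v] * \<theta>2 p [w] + \<theta>3 p [v] * \<theta>3 p [w])"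
  shows "hkt_manifold M ghat I1 I2 I3 \<and>
    potential_1form M ghat I1 I2 I3 (- \<theta>) \<and>
    closed_form M (points M) 1 (- \<theta>)"
proof -
  interpret parallel_lee_form M g ghat I1 I2 I3 \<theta> nabla
    by unfold_locales (use assms in \<open>simp_all add: lchk_manifold_def\<close>)
  show ?thesis
    using smooth_manifold ghat_hyperhermitian D_hkt minus_\<theta>_potential minus_\<theta>_closed
    unfolding hkt_manifold_def by blast
qed

end
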